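(* Let $n$ be a positive integer, let $\mathcal{A}=\mathcal{M}_n(\mathbb{C})$, and let $\mathcal{K}$ be a finite-dimensional Hilbert space. Every OCP map $\varphi:\mathcal{A}\to\mathcal{B}(\mathcal{K})$ has a purification $(\mathcal{K},\mathcal{H},\pi,V)$ with $\mathcal{H}$ finite dimensional. Furthermore, given any such purification $(\mathcal{K},\mathcal{H},\pi,V)$ and any other purification $(\mathcal{K},\mathcal{I},\rho,W)$ of $\varphi$ with $\mathcal{I}$ finite dimensional and for which $(\mathcal{H},\pi)$ is unitarily equivalent to $(\mathcal{I},\rho)$, there exists a unitary intertwiner $U:\mathcal{H}\to\mathcal{I}$ (i.e. a unitary with $U\pi(a)=\rho(a)U$ for all $a\in\mathcal{A}$) such that $UV=W$.
   Context: All $^*$-homomorphisms are unital. $\mathcal{M}_n(\mathbb{C})$ is the $C^*$-algebra of $n\times n$ complex matrices; $\mathcal{B}(\mathcal{K})$ is the algebra of bounded operators on $\mathcal{K}$. An OCP map $\varphi:\mathcal{A}\to\mathcal{B}(\mathcal{K})$ is a completely positive linear map (not necessarily unital). A purification of it is a quadruple $(\mathcal{K},\mathcal{H},\pi,V)$, where $\mathcal{H}$ is a Hilbert space, $\pi:\mathcal{A}\to\mathcal{B}(\mathcal{H})$ is a $^*$-homomorphism, and $V:\mathcal{K}\to\mathcal{H}$ is a bounded linear map such that $V^*\pi(a)V=\varphi(a)$ for all $a\in\mathcal{A}$. Representations $(\mathcal{H},\pi)$ and $(\mathcal{I},\rho)$ of $\mathcal{A}$ are unitarily equivalent if there is a unitary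 $S:\mathcal{H}\to\mathcal{I}$ with $S\pi(a)=\rho(a)S$ for all $a\in\mathcal{A}$. *)

theory Defs
  imports "HOL-Analysis.Analysis" "HOL-Algebra.Module"
begin

section \<open>Complex Hilbert spaces\<close>

text \<open>
  Hilbert spaces are carrier-based, so that a theorem can assert the existence of one. They are
  modules over the field of complex numbers with an inner product which, following the physics
  convention, is linear in its \<^emph>\<open>second\<close> argument. The multiplicative fields that modules
  inherit from the record type of rings are unused.
\<close>

definition complex_ring :: "complex ring" where
  "complex_ring = \<lparr>carrier = UNIV, mult = (*), one = 1, zero = 0, add = (+)\<rparr>"

record 'a cinner_space = "(complex, 'a) module" +
  cinner :: "'a \<Rightarrow> 'a \<Rightarrow> complex" ("\<llangle>_, _\<rrangle>\<index>")

locale inner_product_space = Module.module complex_ring H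
  for H :: "'a cinner_space" (structure) +
  assumes cinner_add_right:
      "\<lbrakk>x \<in> carrier H; y \<in> carrier H; z \<in> carrier H\<rbrakk>
        \<Longrightarrow> \<llangle>x, y \<oplus> z\<rrangle> = \<llangle>x, y\<rrangle> + \<llangle>x, z\<rrangle>"
    and cinner_smult_right:
      "\<lbrakk>x \<in> carrier H; y \<in> carrier H\<rbrakk> \<Longrightarrow> \<llangle>x, c \<odot> y\<rrangle> = c * \<llangle>x, y\<rrangle>"
    and cinner_commute:
      "\<lbrakk>x \<in> carrier H; y \<in> carrier H\<rbrakk> \<Longrightarrow> \<llangle>y, x\<rrangle> = cnj \<llangle>x, y\<rrangle>"
    and cinner_pos:
      "\<lbrakk>x \<in> carrier H; x \<noteq> \<zero>\<rbrakk> \<Longrightarrow> 0 < Re \<llangle>x, x\<rrangle>"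

definition cnorm :: "'a cinner_space \<Rightarrow> 'a \<Rightarrow> real" where
  "cnorm H x = sqrt (Re \<llangle>x, x\<rrangle>\<^bsub>H\<^esub>)"

locale hilbert_space = inner_product_space +
  assumes complete:
    "\<lbrakk>\<And>i :: nat. s i \<in> carrier H;
      \<And>e :: real. 0 < e \<Longrightarrow> \<exists>N. \<forall>i\<ge>N. \<forall>j\<ge>N. cnorm H (s i \<ominus> s j) < e\<rbrakk>
      \<Longrightarrow> \<exists>x\<in>carrier H. (\<lambda>i. cnorm H (s i \<ominus> x)) \<longlonglongrightarrow> 0"

definition fin_dim :: "'a cinner_space \<Rightarrow> bool" where
  "fin_dim H \<longleftrightarrow> (\<exists>B. finite B \<and> B \<subseteq> carrier H \<and>
     (\<forall>x\<in>carrier H. \<exists>c :: 'a \<Rightarrow> complex. x = (\<Oplus>\<^bsub>H\<^esub>b\<in>B. c b \<odot>\<^bsub>H\<^esub> b)))"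


section \<open>Bounded operators\<close>

text \<open>
  An operator is a function that is only meaningful on the carrier of its domain; two operators
  are considered equal if they agree there.
\<close>

definition bounded_ops :: "'a cinner_space \<Rightarrow> 'b cinner_space \<Rightarrow> ('a \<Rightarrow> 'b) set" where
  "bounded_ops H K = {T. T \<in> carrier H \<rightarrow> carrier K \<and>
     (\<forall>x\<in>carrier H. \<forall>y\<in>carrier H. T (x \<oplus>\<^bsub>H\<^esub> y) = T x \<oplus>\<^bsub>K\<^esub> T y) \<and>
     (\<forall>c. \<forall>x\<in>carrier H. T (c \<odot>\<^bsub>H\<^esub> x) = c \<odot>\<^bsub>K\<^esub> T x) \<and>
     (\<exists>C. \<forall>x\<in>carrier H. cnorm K (T x) \<le> C * cnorm H x)}"

text \<open>The value \<open>adj H K T y\<close> is the Riesz representative of \<open>z \<mapsto> \<llangle>y, T z\<rrangle>\<close>.\<close>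

definition adj :: "'a cinner_space \<Rightarrow> 'b cinner_space \<Rightarrow> ('a \<Rightarrow> 'b) \<Rightarrow> 'b \<Rightarrow> 'a" where
  "adj H K T y =
     (THE x. x \<in> carrier H \<and> (\<forall>z\<in>carrier H. \<llangle>x, z\<rrangle>\<^bsub>H\<^esub> = \<llangle>y, T z\<rrangle>\<^bsub>K\<^esub>))"

definition unitary_op :: "'a cinner_space \<Rightarrow> 'b cinner_space \<Rightarrow> ('a \<Rightarrow> 'b) \<Rightarrow> bool" where
  "unitary_op H K U \<longleftrightarrow> U \<in> bounded_ops H K \<and>
     (\<forall>x\<in>carrier H. adj H K U (U x) = x) \<and>
     (\<forall>y\<in>carrier K. U (adj H K U y) = y)"


section \<open>Maps from a matrix algebra to bounded operators\<close>

text \<open>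
  The algebra of \<open>n \<times> n\<close> complex matrices is the type \<open>complex^'n^'n\<close> with \<open>n = CARD('n)\<close>, which
  ranges over all positive integers as \<open>'n\<close> varies.
\<close>

definition matrix_cscale :: "complex \<Rightarrow> complex^'n^'n \<Rightarrow> complex^'n^'n" where
  "matrix_cscale c A = map_matrix ((*) c) A"

definition matrix_adj :: "complex^'n^'n \<Rightarrow> complex^'n^'n" where
  "matrix_adj A = map_matrix cnj (transpose A)"

definition linear_into_ops ::
    "'h cinner_space \<Rightarrow> (complex^'n^'n \<Rightarrow> 'h \<Rightarrow> 'h) \<Rightarrow> bool" where
  "linear_into_ops H \<phi> \<longleftrightarrow> (\<forall>a. \<phi> a \<in> bounded_ops H H) \<and>
     (\<forall>a b. \<forall>x\<in>carrier H. \<phi> (a + b) x = \<phi> a x \<oplus>\<^bsub>H\<^esub> \<phi> b x) \<and>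
     (\<forall>c a. \<forall>x\<in>carrier H. \<phi> (matrix_cscale c a) x = c \<odot>\<^bsub>H\<^esub> \<phi> a x)"

definition unital_star_hom ::
    "'h cinner_space \<Rightarrow> (complex^'n^'n \<Rightarrow> 'h \<Rightarrow> 'h) \<Rightarrow> bool" where
  "unital_star_hom H \<pi> \<longleftrightarrow> linear_into_ops H \<pi> \<and>
     (\<forall>a b. \<forall>x\<in>carrier H. \<pi> (a ** b) x = \<pi> a (\<pi> b x)) \<and>
     (\<forall>a. \<forall>x\<in>carrier H. \<pi> (matrix_adj a) x = adj H H (\<pi> a) x) \<and>
     (\<forall>x\<in>carrier H. \<pi> (mat 1) x = x)"

text \<open>
  An element of \<open>M\<^sub>m(\<A>)\<close> is given by its entries \<open>a i j\<close> with \<open>i, j < m\<close>. It is positive if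
  it is of the form \<open>b\<^sup>* b\<close> in the \<open>C\<^sup>*\<close>-algebra \<open>M\<^sub>m(\<A>)\<close>, where the \<open>(i, k)\<close> entry of \<open>b\<^sup>*\<close> is
  the adjoint of \<open>b k i\<close>.
\<close>

definition positive_matrix_over :: "nat \<Rightarrow> (nat \<Rightarrow> nat \<Rightarrow> complex^'n^'n) \<Rightarrow> bool" where
  "positive_matrix_over m a \<longleftrightarrow>
     (\<exists>b. \<forall>i<m. \<forall>j<m. a i j = (\<Sum>k<m. matrix_adj (b k i) ** b k j))"

text \<open>
  An element \<open>T\<close> of \<open>M\<^sub>m(B(K))\<close> is positive as an operator on the \<open>m\<close>-fold direct sum of \<open>K\<close>,
  that is, \<open>\<llangle>x, T x\<rrangle> \<ge> 0\<close> for all \<open>x = (x\<^sub>0, \<dots>, x\<^sub>m\<^sub>-\<^sub>1)\<close>. The map below is completely positive if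
  all its entrywise amplifications preserve positivity.
\<close>

definition positive_op_matrix :: "'k cinner_space \<Rightarrow> nat \<Rightarrow> (nat \<Rightarrow> nat \<Rightarrow> 'k \<Rightarrow> 'k) \<Rightarrow> bool" where
  "positive_op_matrix K m T \<longleftrightarrow>
     (\<forall>x \<in> {..<m} \<rightarrow> carrier K. (\<Sum>i<m. \<Sum>j<m. \<llangle>x i, T i j (x j)\<rrangle>\<^bsub>K\<^esub>) \<in> \<real>\<^sub>\<ge>\<^sub>0)"

definition completely_positive ::
    "'k cinner_space \<Rightarrow> (complex^'n^'n \<Rightarrow> 'k \<Rightarrow> 'k) \<Rightarrow> bool" where
  "completely_positive K \<phi> \<longleftrightarrow>
     (\<forall>m a. positive_matrix_over m a \<longrightarrow> positive_op_matrix K m (\<lambda>i j. \<phi> (a i j)))"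

definition ocp_map :: "'k cinner_space \<Rightarrow> (complex^'n^'n \<Rightarrow> 'k \<Rightarrow> 'k) \<Rightarrow> bool" where
  "ocp_map K \<phi> \<longleftrightarrow> linear_into_ops K \<phi> \<and> completely_positive K \<phi>"


section \<open>Purifications and intertwiners\<close>

definition purification ::
    "(complex^'n^'n \<Rightarrow> 'k \<Rightarrow> 'k) \<Rightarrow> 'k cinner_space \<Rightarrow> 'h cinner_space \<Rightarrow>
     (complex^'n^'n \<Rightarrow> 'h \<Rightarrow> 'h) \<Rightarrow> ('k \<Rightarrow> 'h) \<Rightarrow> bool" where
  "purification \<phi> K H \<pi> V \<longleftrightarrow>
     hilbert_space H \<and> unital_star_hom H \<pi> \<and> V \<in> bounded_ops K H \<and>
     (\<forall>a. \<forall>x\<in>carrier K. adj K H V (\<pi> a (V x)) = \<phi> a x)"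

definition unitary_intertwiner ::
    "'h cinner_space \<Rightarrow> (complex^'n^'n \<Rightarrow> 'h \<Rightarrow> 'h) \<Rightarrow>
     'i cinner_space \<Rightarrow> (complex^'n^'n \<Rightarrow> 'i \<Rightarrow> 'i) \<Rightarrow> ('h \<Rightarrow> 'i) \<Rightarrow> bool" where
  "unitary_intertwiner H \<pi> I \<rho> U \<longleftrightarrow> unitary_op H I U \<and>
     (\<forall>a. \<forall>x\<in>carrier H. U (\<pi> a x) = \<rho> a (U x))"

definition unitarily_equivalent ::
    "'h cinner_space \<Rightarrow> (complex^'n^'n \<Rightarrow> 'h \<Rightarrow> 'h) \<Rightarrow>
     'i cinner_space \<Rightarrow> (complex^'n^'n \<Rightarrow> 'i \<Rightarrow> 'i) \<Rightarrow> bool" where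
  "unitarily_equivalent H \<pi> I \<rho> \<longleftrightarrow> (\<exists>S. unitary_intertwiner H \<pi> I \<rho> S)"

end

theory Submission
  imports Defs
begin

text \<open>
  A completely positive map is determined by its Choi matrix \<open>\<llangle>e, \<phi> (E\<^sub>i\<^sub>j) f\<rrangle>\<close>, indexed by
  pairs of a matrix index and a vector of an orthonormal basis of \<open>K\<close>. It is positive
  semidefinite, hence a Gram matrix, and the Gram vectors assemble to an operator \<open>V\<close> into a direct
  sum of copies of the standard representation that compresses to \<open>\<phi>\<close>.

  For uniqueness, the vectors \<open>\<pi> (E\<^sub>k\<^sub>i) (V x)\<close> and \<open>\<rho> (E\<^sub>k\<^sub>i) (W x)\<close> have the same Gram matrix, which is
  read off from \<open>\<phi>\<close>. Starting from any unitary intertwiner, finitely many corrections by complex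
  quasi-reflections that commute with \<open>\<rho>\<close> produce one that maps the first family to the second.
  Since the \<open>E\<^sub>i\<^sub>i\<close> sum to the identity, it maps \<open>V x\<close> to \<open>W x\<close>.
\<close>

section \<open>Inner product spaces\<close>

text \<open>Purifications need not be minimal: the vectors \<open>\<pi> a (V x)\<close> may fail to
  span \<open>H\<close>. Equal Gram matrices therefore only give an intertwining isometry between
  subrepresentations, and the obstacle is to extend it to their orthogonal complements. Unitary
  equivalence is what makes an extension possible; correcting a given intertwiner step by step
  avoids complements, dimension counts and decompositions into irreducibles.

  The index \<open>k\<close> is fixed, so both families lie in the ranges of
  \<open>\<pi> (matrix_unit k k)\<close> and \<open>\<rho> (matrix_unit k k)\<close>. These ranges
  are the multiplicity spaces: an intertwiner is determined by what it does there, and any unitary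
  between them is induced by one. This reduces the problem to finitely many vectors without further
  structure.

  For distinct \<open>p\<close> and \<open>q\<close> of equal norm, the ordinary reflection along
  \<open>p - q\<close> maps \<open>p\<close> to \<open>q\<close> only if their inner product is
  real. This is why the coefficient of the correction has to be complex.\<close>

lemma complex_ring_simps [simp]:
  "carrier complex_ring = UNIV" "a \<otimes>\<^bsub>complex_ring\<^esub> b = a * b" "a \<oplus>\<^bsub>complex_ring\<^esub> b = a + b"
  "\<one>\<^bsub>complex_ring\<^esub> = 1" "\<zero>\<^bsub>complex_ring\<^esub> = 0"
  by (simp_all add: complex_ring_def)

lemma cring_complex_ring: "cring complex_ring"
proof (rule cringI)
  show "abelian_group complex_ring"
  proof (rule abelian_groupI)
    show "\<exists>y\<in>carrier complex_ring. y \<oplus>\<^bsub>complex_ring\<^esub> x = \<zero>\<^bsub>complex_ring\<^esub>" for x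
      by (intro bexI[of _ "- x"]) simp_all
  qed (simp_all add: add_ac)
  show "comm_monoid complex_ring"
    by (rule comm_monoidI) (simp_all add: mult_ac)
qed (simp add: distrib_right)

context inner_product_space
begin

lemma smult_in_carrier [simp, intro]: "x \<in> carrier H \<Longrightarrow> c \<odot> x \<in> carrier H"
  by (simp add: smult_closed)

lemma cinner_smult_left:
  assumes "x \<in> carrier H" "y \<in> carrier H"
  shows "\<llangle>c \<odot> x, y\<rrangle> = cnj c * \<llangle>x, y\<rrangle>"
  using assms cinner_commute[of y "c \<odot> x"] cinner_commute[of y x]
  by (simp add: cinner_smult_right)

lemma cinner_zero_right [simp]: "x \<in> carrier H \<Longrightarrow> \<llangle>x, \<zero>\<rrangle> = 0"
  using cinner_add_right[of x \<zero> \<zero>] by simp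

lemma cinner_minus_right:
  assumes "x \<in> carrier H" "y \<in> carrier H" "z \<in> carrier H"
  shows "\<llangle>x, y \<ominus> z\<rrangle> = \<llangle>x, y\<rrangle> - \<llangle>x, z\<rrangle>"
proof -
  have "\<llangle>x, (y \<ominus> z) \<oplus> z\<rrangle> = \<llangle>x, y\<rrangle>"
    using assms by (simp add: M.minus_eq M.a_assoc M.l_neg)
  then show ?thesis
    using assms by (simp add: cinner_add_right eq_diff_eq)
qed

lemma cinner_minus_left:
  assumes "x \<in> carrier H" "y \<in> carrier H" "z \<in> carrier H"
  shows "\<llangle>x \<ominus> y, z\<rrangle> = \<llangle>x, z\<rrangle> - \<llangle>y, z\<rrangle>"
  using assms cinner_commute[of z "x \<ominus> y"] cinner_commute[of z x] cinner_commute[of z y]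
  by (simp add: cinner_minus_right)

lemma cinner_finsum_right:
  assumes "f \<in> A \<rightarrow> carrier H" "x \<in> carrier H"
  shows "\<llangle>x, (\<Oplus>i\<in>A. f i)\<rrangle> = (\<Sum>i\<in>A. \<llangle>x, f i\<rrangle>)"
  using assms
proof (induction A rule: infinite_finite_induct)
  case (insert a A)
  then have "f \<in> A \<rightarrow> carrier H" "f a \<in> carrier H" by auto
  with insert show ?case
    by (simp add: M.finsum_insert cinner_add_right)
qed (auto simp: M.finsum_infinite)

lemma cinner_finsum_left:
  assumes "f \<in> A \<rightarrow> carrier H" "x \<in> carrier H"
  shows "\<llangle>(\<Oplus>i\<in>A. f i), x\<rrangle> = (\<Sum>i\<in>A. \<llangle>f i, x\<rrangle>)"
proof -
  have "cnj \<llangle>x, f i\<rrangle> = \<llangle>f i, x\<rrangle>" if "i \<in> A" for i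
    using assms that by (intro cinner_commute[symmetric]) auto
  then show ?thesis
    using assms cinner_commute[of x "\<Oplus>i\<in>A. f i"]
    by (simp add: cinner_finsum_right)
qed

lemma cinner_self_real: "x \<in> carrier H \<Longrightarrow> \<llangle>x, x\<rrangle> = of_real (Re \<llangle>x, x\<rrangle>)"
proof -
  assume x: "x \<in> carrier H"
  have "Im \<llangle>x, x\<rrangle> = - Im \<llangle>x, x\<rrangle>"
    using arg_cong[OF cinner_commute[OF x x], of Im] by simp
  then have "Im \<llangle>x, x\<rrangle> = 0" by linarith
  then show ?thesis by (simp add: complex_eq_iff)
qed

lemma cinner_self_nonneg: "x \<in> carrier H \<Longrightarrow> 0 \<le> Re \<llangle>x, x\<rrangle>"
  using cinner_pos[of x] by (cases "x = \<zero>") auto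

lemma cinner_self_eq_0: "x \<in> carrier H \<Longrightarrow> \<llangle>x, x\<rrangle> = 0 \<longleftrightarrow> x = \<zero>"
  using cinner_pos[of x] by (cases "x = \<zero>") auto

lemma minus_eq_zeroD:
  assumes "x \<in> carrier H" "y \<in> carrier H" "x \<ominus> y = \<zero>"
  shows "x = y"
proof -
  have "x = (x \<ominus> y) \<oplus> y"
    using assms(1,2) by (simp add: M.minus_eq M.a_assoc M.l_neg)
  also have "\<dots> = y"
    unfolding assms(3) using assms(2) by simp
  finally show ?thesis .
qed

text \<open>Nearly all vector identities below are proved by pairing with an arbitrary
  \<open>z\<close>. This turns sums in the module into sums of complex numbers, where the usual
  algebra is available.\<close>

lemma cinner_eqI:
  assumes "x \<in> carrier H" "y \<in> carrier H" "\<And>z. z \<in> carrier H \<Longrightarrow> \<llangle>z, x\<rrangle> = \<llangle>z, y\<rrangle>"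
  shows "x = y"
proof -
  have "x \<ominus> y \<in> carrier H"
    using assms(1,2) by simp
  moreover have "\<llangle>x \<ominus> y, x \<ominus> y\<rrangle> = 0"
    using assms(1,2) assms(3)[OF calculation] by (simp add: cinner_minus_right)
  ultimately have "x \<ominus> y = \<zero>"
    by (simp only: cinner_self_eq_0)
  then show ?thesis
    by (rule minus_eq_zeroD[OF assms(1,2)])
qed

lemma cinner_eqI_left:
  assumes "x \<in> carrier H" "y \<in> carrier H" "\<And>z. z \<in> carrier H \<Longrightarrow> \<llangle>x, z\<rrangle> = \<llangle>y, z\<rrangle>"
  shows "x = y"
  using assms cinner_commute[of x] cinner_commute[of y] by (intro cinner_eqI) metis+

text \<open>Expand the squared norm of \<open>x \<ominus> y\<close>. This weak form of the
  Cauchy-Schwarz inequality is enough to bound the operator \<open>V\<close> of a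
  purification.\<close>

lemma Re_cinner_le:
  assumes "x \<in> carrier H" "y \<in> carrier H"
  shows "2 * Re \<llangle>x, y\<rrangle> \<le> (cnorm H x)\<^sup>2 + (cnorm H y)\<^sup>2"
  using assms cinner_self_nonneg[of "x \<ominus> y"] cinner_self_nonneg[of x] cinner_self_nonneg[of y]
    arg_cong[OF cinner_commute[OF assms], of Re]
  by (simp add: cnorm_def cinner_minus_left cinner_minus_right)

section \<open>Orthonormal bases\<close>

definition orthonormal_basis :: "'a set \<Rightarrow> bool" where
  "orthonormal_basis E \<longleftrightarrow> finite E \<and> E \<subseteq> carrier H \<and>
     (\<forall>e\<in>E. \<forall>f\<in>E. \<llangle>e, f\<rrangle> = (if e = f then 1 else 0)) \<and>
     (\<forall>x\<in>carrier H. x = (\<Oplus>e\<in>E. \<llangle>e, x\<rrangle> \<odot> e))"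

text \<open>That \<open>E\<close> spans \<open>B\<close> is expressed after pairing with all
  \<open>z\<close>, so that the induction rearranges complex sums only.\<close>

lemma gram_schmidt:
  assumes "finite B" "B \<subseteq> carrier H"
  shows "\<exists>E. finite E \<and> E \<subseteq> carrier H \<and>
    (\<forall>e\<in>E. \<forall>f\<in>E. \<llangle>e, f\<rrangle> = (if e = f then 1 else 0)) \<and>
    (\<forall>b\<in>B. \<forall>z\<in>carrier H. \<llangle>z, b\<rrangle> = (\<Sum>e\<in>E. \<llangle>e, b\<rrangle> * \<llangle>z, e\<rrangle>))"
  using assms
proof (induction B)
  case empty
  then show ?case by (intro exI[of _ "{}"]) auto
next
  case (insert b B)
  have b: "b \<in> carrier H" and B: "B \<subseteq> carrier H" using insert.prems by auto
  obtain E where E: "finite E" "E \<subseteq> carrier H"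
    and on: "\<forall>e\<in>E. \<forall>f\<in>E. \<llangle>e, f\<rrangle> = (if e = f then 1 else 0)"
    and ex: "\<forall>x\<in>B. \<forall>z\<in>carrier H. \<llangle>z, x\<rrangle> = (\<Sum>e\<in>E. \<llangle>e, x\<rrangle> * \<llangle>z, e\<rrangle>)"
    using insert.IH[OF B] by (elim exE conjE) (rule that)
  \<comment> \<open>The orthogonal projection of \<open>b\<close> to the span of \<open>E\<close>.
    The remainder \<open>d\<close> either vanishes, and \<open>E\<close> already works, or is
    normalized and added to \<open>E\<close>.\<close>
  define p where "p = (\<Oplus>e\<in>E. \<llangle>e, b\<rrangle> \<odot> e)"
  have pf: "(\<lambda>e. \<llangle>e, b\<rrangle> \<odot> e) \<in> E \<rightarrow> carrier H" using E by auto
  have p: "p \<in> carrier H" using pf unfolding p_def by (rule M.finsum_closed)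
  have zp: "\<llangle>z, p\<rrangle> = (\<Sum>e\<in>E. \<llangle>e, b\<rrangle> * \<llangle>z, e\<rrangle>)" if "z \<in> carrier H" for z
    unfolding p_def cinner_finsum_right[OF pf that]
    using E that by (intro sum.cong) (auto simp: cinner_smult_right)
  define d where "d = b \<ominus> p"
  have d: "d \<in> carrier H" using b p by (simp add: d_def)
  have ed: "\<llangle>e, d\<rrangle> = 0" if "e \<in> E" for e
  proof -
    have "\<llangle>e, p\<rrangle> = (\<Sum>f\<in>E. if f = e then \<llangle>e, b\<rrangle> else 0)"
      using E that unfolding zp[OF subsetD[OF E(2) that]] by (intro sum.cong) (auto simp: on)
    moreover have "e \<in> carrier H" using E that by blast
    ultimately show ?thesis
      using E(1) b p that by (simp add: d_def cinner_minus_right)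
  qed
  show ?case
  proof (cases "d = \<zero>")
    case True
    then have "b = p" using b p unfolding d_def by (rule minus_eq_zeroD[rotated 2])
    then have "\<llangle>z, b\<rrangle> = (\<Sum>e\<in>E. \<llangle>e, b\<rrangle> * \<llangle>z, e\<rrangle>)" if "z \<in> carrier H" for z
      using zp[OF that] by simp
    then show ?thesis
      using E on ex by (intro exI[of _ E] conjI) blast+
  next
    case False
    define N where "N = sqrt (Re \<llangle>d, d\<rrangle>)"
    have N: "N > 0" using cinner_pos[OF d False] by (simp add: N_def)
    have NN: "\<llangle>d, d\<rrangle> = of_real N * of_real N"
      using cinner_self_real[OF d] cinner_self_nonneg[OF d]
      by (simp add: N_def flip: of_real_mult)
    define e' where "e' = complex_of_real (1 / N) \<odot> d"
    have e': "e' \<in> carrier H" using d by (simp add: e'_def)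
    have ee': "\<llangle>e, e'\<rrangle> = 0" "\<llangle>e', e\<rrangle> = 0" if "e \<in> E" for e
    proof -
      have e: "e \<in> carrier H" using that E by blast
      show "\<llangle>e, e'\<rrangle> = 0" using e d ed[OF that] by (simp add: e'_def cinner_smult_right)
      then show "\<llangle>e', e\<rrangle> = 0" using cinner_commute[OF e e'] by simp
    qed
    have e'e': "\<llangle>e', e'\<rrangle> = 1"
      using d N by (simp add: e'_def cinner_smult_right cinner_smult_left NN)
    have notin: "e' \<notin> E" using ee' e'e' by force
    have e'b: "\<llangle>e', b\<rrangle> = N"
    proof -
      have "\<llangle>e', d\<rrangle> = N"
        using d N by (simp add: e'_def cinner_smult_left NN)
      moreover have "\<llangle>e', p\<rrangle> = 0"
        using e' ee' by (simp add: zp)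
      ultimately show ?thesis
        using e' b p by (simp add: d_def cinner_minus_right)
    qed
    have "\<llangle>z, b\<rrangle> = (\<Sum>e\<in>insert e' E. \<llangle>e, b\<rrangle> * \<llangle>z, e\<rrangle>)" if z: "z \<in> carrier H" for z
    proof -
      have "N * \<llangle>z, e'\<rrangle> = \<llangle>z, d\<rrangle>"
        using z d N by (simp add: e'_def cinner_smult_right)
      then have "N * \<llangle>z, e'\<rrangle> = \<llangle>z, b\<rrangle> - \<llangle>z, p\<rrangle>"
        using z b p by (simp add: d_def cinner_minus_right)
      then show ?thesis
        using E notin by (simp add: e'b zp[OF z])
    qed
    moreover have "\<llangle>z, x\<rrangle> = (\<Sum>e\<in>insert e' E. \<llangle>e, x\<rrangle> * \<llangle>z, e\<rrangle>)"
      if x: "x \<in> B" and z: "z \<in> carrier H" for x z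
    proof -
      \<comment> \<open>The old expansion of \<open>x\<close>, paired with \<open>e'\<close>, has
        only zero terms, so the enlarged basis does not change it.\<close>
      have "\<llangle>e', x\<rrangle> = 0"
        using bspec[OF bspec[OF ex x] e'] ee' by simp
      then show ?thesis
        using E notin bspec[OF bspec[OF ex x] z] by simp
    qed
    moreover have "\<forall>e\<in>insert e' E. \<forall>f\<in>insert e' E. \<llangle>e, f\<rrangle> = (if e = f then 1 else 0)"
      using on ee' e'e' notin by auto
    moreover have "finite (insert e' E)" "insert e' E \<subseteq> carrier H"
      using E e' by auto
    ultimately show ?thesis
      by (intro exI[of _ "insert e' E"] conjI) blast+
  qed
qed

lemma fin_dim_orthonormal_basis:
  assumes "fin_dim H"
  obtains E where "orthonormal_basis E"
proof -
  obtain B where B: "finite B" "B \<subseteq> carrier H"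
    and span: "\<forall>x\<in>carrier H. \<exists>c :: 'a \<Rightarrow> complex. x = (\<Oplus>b\<in>B. c b \<odot> b)"
    using assms unfolding fin_dim_def by (elim exE conjE) (rule that)
  obtain E where E: "finite E" "E \<subseteq> carrier H"
    and on: "\<forall>e\<in>E. \<forall>f\<in>E. \<llangle>e, f\<rrangle> = (if e = f then 1 else 0)"
    and ex: "\<forall>x\<in>B. \<forall>z\<in>carrier H. \<llangle>z, x\<rrangle> = (\<Sum>e\<in>E. \<llangle>e, x\<rrangle> * \<llangle>z, e\<rrangle>)"
    using gram_schmidt[OF B] by (elim exE conjE) (rule that)
  have "x = (\<Oplus>e\<in>E. \<llangle>e, x\<rrangle> \<odot> e)" if x: "x \<in> carrier H" for x
  proof (rule cinner_eqI[OF x])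
    have Ef: "(\<lambda>e. \<llangle>e, x\<rrangle> \<odot> e) \<in> E \<rightarrow> carrier H" using E by auto
    show "(\<Oplus>e\<in>E. \<llangle>e, x\<rrangle> \<odot> e) \<in> carrier H" using Ef by (rule M.finsum_closed)
    fix z assume z: "z \<in> carrier H"
    obtain c :: "'a \<Rightarrow> complex" where c: "x = (\<Oplus>b\<in>B. c b \<odot> b)" using span x by blast
    have Bf: "(\<lambda>b. c b \<odot> b) \<in> B \<rightarrow> carrier H" using B by auto
    have zx: "\<llangle>z, x\<rrangle> = (\<Sum>b\<in>B. c b * \<llangle>z, b\<rrangle>)" if "z \<in> carrier H" for z
      unfolding c cinner_finsum_right[OF Bf that]
      using B that by (intro sum.cong) (auto simp: cinner_smult_right)
    have "\<llangle>z, x\<rrangle> = (\<Sum>b\<in>B. \<Sum>e\<in>E. c b * (\<llangle>e, b\<rrangle> * \<llangle>z, e\<rrangle>))"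
      using z bspec[OF bspec[OF ex] z] by (simp add: zx sum_distrib_left)
    \<comment> \<open>After the swap the coefficient of \<open>e\<close> is the expansion of
      \<open>\<llangle>e, x\<rrangle>\<close> over \<open>B\<close>, that is, \<open>zx\<close> for
      \<open>e\<close> in place of \<open>z\<close>.\<close>
    also have "\<dots> = (\<Sum>e\<in>E. \<Sum>b\<in>B. c b * \<llangle>e, b\<rrangle> * \<llangle>z, e\<rrangle>)"
      by (subst sum.swap) (simp add: mult.assoc)
    also have "\<dots> = (\<Sum>e\<in>E. \<llangle>e, x\<rrangle> * \<llangle>z, e\<rrangle>)"
      using E by (intro sum.cong) (auto simp: zx sum_distrib_right subset_iff)
    also have "\<dots> = (\<Sum>e\<in>E. \<llangle>z, \<llangle>e, x\<rrangle> \<odot> e\<rrangle>)"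
      using E z by (intro sum.cong) (auto simp: cinner_smult_right subset_iff)
    also have "\<dots> = \<llangle>z, (\<Oplus>e\<in>E. \<llangle>e, x\<rrangle> \<odot> e)\<rrangle>"
      by (rule cinner_finsum_right[OF Ef z, symmetric])
    finally show "\<llangle>z, x\<rrangle> = \<llangle>z, (\<Oplus>e\<in>E. \<llangle>e, x\<rrangle> \<odot> e)\<rrangle>" .
  qed
  then show thesis
    using that[of E] E on unfolding orthonormal_basis_def by blast
qed

end

section \<open>Adjoints and isometric isomorphisms\<close>

lemma bounded_opsD:
  assumes "T \<in> bounded_ops H K"
  shows "x \<in> carrier H \<Longrightarrow> T x \<in> carrier K"
    and "x \<in> carrier H \<Longrightarrow> y \<in> carrier H \<Longrightarrow> T (x \<oplus>\<^bsub>H\<^esub> y) = T x \<oplus>\<^bsub>K\<^esub> T y"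
    and "x \<in> carrier H \<Longrightarrow> T (c \<odot>\<^bsub>H\<^esub> x) = c \<odot>\<^bsub>K\<^esub> T x"
  using assms unfolding bounded_ops_def by auto

locale inner_product_space_pair = H: inner_product_space H + K: inner_product_space K
  for H :: "'a cinner_space" and K :: "'b cinner_space"
begin

lemma cinner_op_finsum:
  assumes T: "T \<in> bounded_ops H K" and f: "f \<in> A \<rightarrow> carrier H" and A: "finite A"
    and y: "y \<in> carrier K"
  shows "\<llangle>y, T (\<Oplus>\<^bsub>H\<^esub>i\<in>A. f i)\<rrangle>\<^bsub>K\<^esub> = (\<Sum>i\<in>A. \<llangle>y, T (f i)\<rrangle>\<^bsub>K\<^esub>)"
  using A f
proof (induction A)
  case empty
  \<comment> \<open>Additivity makes this number equal to its double, hence zero.\<close>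
  have "\<llangle>y, T (\<zero>\<^bsub>H\<^esub> \<oplus>\<^bsub>H\<^esub> \<zero>\<^bsub>H\<^esub>)\<rrangle>\<^bsub>K\<^esub> = \<llangle>y, T \<zero>\<^bsub>H\<^esub>\<rrangle>\<^bsub>K\<^esub> + \<llangle>y, T \<zero>\<^bsub>H\<^esub>\<rrangle>\<^bsub>K\<^esub>"
    using y bounded_opsD(1)[OF T H.M.zero_closed]
    unfolding bounded_opsD(2)[OF T H.M.zero_closed H.M.zero_closed] by (simp add: K.cinner_add_right)
  then show ?case by simp
next
  case (insert a A)
  have f: "f \<in> A \<rightarrow> carrier H" "f a \<in> carrier H" using insert.prems by auto
  have s: "(\<Oplus>\<^bsub>H\<^esub>i\<in>A. f i) \<in> carrier H" using f(1) by (rule H.M.finsum_closed)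
  show ?case
    using insert.hyps insert.IH[OF f(1)] f y s bounded_opsD(1)[OF T s] bounded_opsD(1)[OF T f(2)]
    by (simp add: H.M.finsum_insert bounded_opsD(2)[OF T] K.cinner_add_right)
qed

lemma cinner_op_basis:
  assumes T: "T \<in> bounded_ops H K" and E: "H.orthonormal_basis E"
    and x: "x \<in> carrier H" and y: "y \<in> carrier K"
  shows "\<llangle>y, T x\<rrangle>\<^bsub>K\<^esub> = (\<Sum>e\<in>E. \<llangle>e, x\<rrangle>\<^bsub>H\<^esub> * \<llangle>y, T e\<rrangle>\<^bsub>K\<^esub>)"
proof -
  have EH: "finite E" "E \<subseteq> carrier H" and ex: "x = (\<Oplus>\<^bsub>H\<^esub>e\<in>E. \<llangle>e, x\<rrangle>\<^bsub>H\<^esub> \<odot>\<^bsub>H\<^esub> e)"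
    using E x unfolding H.orthonormal_basis_def by blast+
  have "\<llangle>y, T x\<rrangle>\<^bsub>K\<^esub> = \<llangle>y, T (\<Oplus>\<^bsub>H\<^esub>e\<in>E. \<llangle>e, x\<rrangle>\<^bsub>H\<^esub> \<odot>\<^bsub>H\<^esub> e)\<rrangle>\<^bsub>K\<^esub>"
    using ex by (rule arg_cong)
  also have "\<dots> = (\<Sum>e\<in>E. \<llangle>y, T (\<llangle>e, x\<rrangle>\<^bsub>H\<^esub> \<odot>\<^bsub>H\<^esub> e)\<rrangle>\<^bsub>K\<^esub>)"
    using EH by (intro cinner_op_finsum[OF T _ _ y]) auto
  also have "\<dots> = (\<Sum>e\<in>E. \<llangle>e, x\<rrangle>\<^bsub>H\<^esub> * \<llangle>y, T e\<rrangle>\<^bsub>K\<^esub>)"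
  proof (rule sum.cong[OF refl])
    fix e assume "e \<in> E"
    then have e: "e \<in> carrier H" using EH by blast
    show "\<llangle>y, T (\<llangle>e, x\<rrangle>\<^bsub>H\<^esub> \<odot>\<^bsub>H\<^esub> e)\<rrangle>\<^bsub>K\<^esub> = \<llangle>e, x\<rrangle>\<^bsub>H\<^esub> * \<llangle>y, T e\<rrangle>\<^bsub>K\<^esub>"
      using y bounded_opsD(1)[OF T e] unfolding bounded_opsD(3)[OF T e]
      by (simp add: K.cinner_smult_right)
  qed
  finally show ?thesis .
qed

lemma adj_eqI:
  assumes "x \<in> carrier H" "\<And>z. z \<in> carrier H \<Longrightarrow> \<llangle>x, z\<rrangle>\<^bsub>H\<^esub> = \<llangle>y, T z\<rrangle>\<^bsub>K\<^esub>"
  shows "adj H K T y = x"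
  unfolding adj_def
proof (rule the_equality)
  show "x \<in> carrier H \<and> (\<forall>z\<in>carrier H. \<llangle>x, z\<rrangle>\<^bsub>H\<^esub> = \<llangle>y, T z\<rrangle>\<^bsub>K\<^esub>)"
    using assms by blast
  fix x' assume "x' \<in> carrier H \<and> (\<forall>z\<in>carrier H. \<llangle>x', z\<rrangle>\<^bsub>H\<^esub> = \<llangle>y, T z\<rrangle>\<^bsub>K\<^esub>)"
  then show "x' = x"
    using assms by (intro H.cinner_eqI_left) auto
qed

text \<open>Because \<open>adj\<close> is a definite description, it says nothing until a Riesz
  representative is exhibited. An orthonormal basis provides one explicitly; its coefficients are
  conjugated since the inner product is conjugate-linear on the left.\<close>

lemma adj:
  assumes fin: "fin_dim H" and T: "T \<in> bounded_ops H K" and y: "y \<in> carrier K"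
  shows "adj H K T y \<in> carrier H"
    and "z \<in> carrier H \<Longrightarrow> \<llangle>adj H K T y, z\<rrangle>\<^bsub>H\<^esub> = \<llangle>y, T z\<rrangle>\<^bsub>K\<^esub>"
proof -
  obtain E where E: "H.orthonormal_basis E"
    using H.fin_dim_orthonormal_basis[OF fin] .
  then have EH: "finite E" "E \<subseteq> carrier H"
    unfolding H.orthonormal_basis_def by blast+
  define x where "x = (\<Oplus>\<^bsub>H\<^esub>e\<in>E. cnj \<llangle>y, T e\<rrangle>\<^bsub>K\<^esub> \<odot>\<^bsub>H\<^esub> e)"
  have f: "(\<lambda>e. cnj \<llangle>y, T e\<rrangle>\<^bsub>K\<^esub> \<odot>\<^bsub>H\<^esub> e) \<in> E \<rightarrow> carrier H" using EH by auto
  have x: "x \<in> carrier H" unfolding x_def using f by (rule H.M.finsum_closed)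
  have xz: "\<llangle>x, z\<rrangle>\<^bsub>H\<^esub> = \<llangle>y, T z\<rrangle>\<^bsub>K\<^esub>" if z: "z \<in> carrier H" for z
  proof -
    have "\<llangle>x, z\<rrangle>\<^bsub>H\<^esub> = (\<Sum>e\<in>E. \<llangle>cnj \<llangle>y, T e\<rrangle>\<^bsub>K\<^esub> \<odot>\<^bsub>H\<^esub> e, z\<rrangle>\<^bsub>H\<^esub>)"
      unfolding x_def by (rule H.cinner_finsum_left[OF f z])
    also have "\<dots> = (\<Sum>e\<in>E. \<llangle>e, z\<rrangle>\<^bsub>H\<^esub> * \<llangle>y, T e\<rrangle>\<^bsub>K\<^esub>)"
    proof (rule sum.cong[OF refl])
      fix e assume "e \<in> E"
      then have e: "e \<in> carrier H" using EH by blast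
      show "\<llangle>cnj \<llangle>y, T e\<rrangle>\<^bsub>K\<^esub> \<odot>\<^bsub>H\<^esub> e, z\<rrangle>\<^bsub>H\<^esub> = \<llangle>e, z\<rrangle>\<^bsub>H\<^esub> * \<llangle>y, T e\<rrangle>\<^bsub>K\<^esub>"
        using e z by (simp add: H.cinner_smult_left)
    qed
    also have "\<dots> = \<llangle>y, T z\<rrangle>\<^bsub>K\<^esub>"
      by (rule cinner_op_basis[OF T E z y, symmetric])
    finally show ?thesis .
  qed
  have "adj H K T y = x" using x xz by (rule adj_eqI)
  then show "adj H K T y \<in> carrier H"
    and "z \<in> carrier H \<Longrightarrow> \<llangle>adj H K T y, z\<rrangle>\<^bsub>H\<^esub> = \<llangle>y, T z\<rrangle>\<^bsub>K\<^esub>"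
    using x xz by simp_all
qed

end

text \<open>Unitarity without \<open>adj\<close>, which makes composition immediate. Linearity and
  boundedness are consequences.\<close>

definition isometric_iso :: "'a cinner_space \<Rightarrow> 'b cinner_space \<Rightarrow> ('a \<Rightarrow> 'b) \<Rightarrow> bool" where
  "isometric_iso H K U \<longleftrightarrow> U ` carrier H = carrier K \<and>
     (\<forall>x\<in>carrier H. \<forall>y\<in>carrier H. \<llangle>U x, U y\<rrangle>\<^bsub>K\<^esub> = \<llangle>x, y\<rrangle>\<^bsub>H\<^esub>)"

lemma isometric_iso_in_carrier:
  "isometric_iso H K U \<Longrightarrow> x \<in> carrier H \<Longrightarrow> U x \<in> carrier K"
  unfolding isometric_iso_def by blast

lemma isometric_iso_cinner:
  "isometric_iso H K U \<Longrightarrow> x \<in> carrier H \<Longrightarrow> y \<in> carrier H \<Longrightarrow> \<llangle>U x, U y\<rrangle>\<^bsub>K\<^esub> = \<llangle>x, y\<rrangle>\<^bsub>H\<^esub>"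
  unfolding isometric_iso_def by blast

lemma isometric_iso_comp:
  assumes "isometric_iso H K U" "isometric_iso K L U'"
  shows "isometric_iso H L (\<lambda>x. U' (U x))"
proof -
  have "(\<lambda>x. U' (U x)) ` carrier H = U' ` U ` carrier H" by (simp add: image_image)
  then show ?thesis
    using assms isometric_iso_in_carrier[OF assms(1)]
    unfolding isometric_iso_def by simp
qed

context inner_product_space_pair
begin

text \<open>By surjectivity every test vector has the form \<open>U z'\<close>, and pairings with it
  can be pulled back to \<open>H\<close>, where linearity is known.\<close>

lemma isometric_iso_linear:
  assumes U: "isometric_iso H K U"
  shows "x \<in> carrier H \<Longrightarrow> y \<in> carrier H \<Longrightarrow> U (x \<oplus>\<^bsub>H\<^esub> y) = U x \<oplus>\<^bsub>K\<^esub> U y"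
    and "x \<in> carrier H \<Longrightarrow> U (c \<odot>\<^bsub>H\<^esub> x) = c \<odot>\<^bsub>K\<^esub> U x"
proof -
  note closed = isometric_iso_in_carrier[OF U] and iso = isometric_iso_cinner[OF U]
  show "U (x \<oplus>\<^bsub>H\<^esub> y) = U x \<oplus>\<^bsub>K\<^esub> U y" if xy: "x \<in> carrier H" "y \<in> carrier H"
  proof (rule K.cinner_eqI)
    fix z assume "z \<in> carrier K"
    then obtain z' where z: "z' \<in> carrier H" "z = U z'"
      using U unfolding isometric_iso_def by blast
    show "\<llangle>z, U (x \<oplus>\<^bsub>H\<^esub> y)\<rrangle>\<^bsub>K\<^esub> = \<llangle>z, U x \<oplus>\<^bsub>K\<^esub> U y\<rrangle>\<^bsub>K\<^esub>"
      using xy z closed by (simp add: H.cinner_add_right K.cinner_add_right iso)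
  qed (use xy closed in simp_all)
  show "U (c \<odot>\<^bsub>H\<^esub> x) = c \<odot>\<^bsub>K\<^esub> U x" if x: "x \<in> carrier H"
  proof (rule K.cinner_eqI)
    fix z assume "z \<in> carrier K"
    then obtain z' where z: "z' \<in> carrier H" "z = U z'"
      using U unfolding isometric_iso_def by blast
    show "\<llangle>z, U (c \<odot>\<^bsub>H\<^esub> x)\<rrangle>\<^bsub>K\<^esub> = \<llangle>z, c \<odot>\<^bsub>K\<^esub> U x\<rrangle>\<^bsub>K\<^esub>"
      using x z closed by (simp add: H.cinner_smult_right K.cinner_smult_right iso)
  qed (use x closed in simp_all)
qed

lemma isometric_iso_bounded:
  assumes U: "isometric_iso H K U"
  shows "U \<in> bounded_ops H K"
proof -
  have "\<forall>x\<in>carrier H. cnorm K (U x) \<le> 1 * cnorm H x"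
    by (simp add: cnorm_def isometric_iso_cinner[OF U])
  then show ?thesis
    unfolding bounded_ops_def
    using isometric_iso_linear[OF U] isometric_iso_in_carrier[OF U] by blast
qed

lemma isometric_iso_unitary_op:
  assumes U: "isometric_iso H K U"
  shows "unitary_op H K U"
proof -
  have adj_U: "adj H K U (U x) = x" if "x \<in> carrier H" for x
    using that by (intro adj_eqI) (simp_all add: isometric_iso_cinner[OF U])
  moreover have "U (adj H K U y) = y" if y: "y \<in> carrier K" for y
  proof -
    obtain x where x: "x \<in> carrier H" "y = U x"
      using U y unfolding isometric_iso_def by blast
    then show ?thesis using adj_U by simp
  qed
  ultimately show ?thesis
    using isometric_iso_bounded[OF U] unfolding unitary_op_def by blast
qed

lemma unitary_op_isometric_iso:
  assumes fin: "fin_dim H" and U: "unitary_op H K U"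
  shows "isometric_iso H K U"
proof -
  have B: "U \<in> bounded_ops H K" and l: "\<And>x. x \<in> carrier H \<Longrightarrow> adj H K U (U x) = x"
    and r: "\<And>y. y \<in> carrier K \<Longrightarrow> U (adj H K U y) = y"
    using U unfolding unitary_op_def by blast+
  note closed = bounded_opsD(1)[OF B]
  have "\<llangle>U x, U y\<rrangle>\<^bsub>K\<^esub> = \<llangle>x, y\<rrangle>\<^bsub>H\<^esub>" if x: "x \<in> carrier H" and y: "y \<in> carrier H" for x y
    using adj(2)[OF fin B closed[OF x] y] l[OF x] by simp
  moreover have "U ` carrier H = carrier K"
  proof
    show "U ` carrier H \<subseteq> carrier K" using closed by blast
    show "carrier K \<subseteq> U ` carrier H"
    proof
      fix y assume y: "y \<in> carrier K"
      show "y \<in> U ` carrier H"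
        using r[OF y, symmetric] adj(1)[OF fin B y] by (rule image_eqI)
    qed
  qed
  ultimately show ?thesis
    unfolding isometric_iso_def by blast
qed

end

section \<open>Representations of matrix algebras\<close>

definition matrix_unit :: "'n \<Rightarrow> 'n \<Rightarrow> complex^'n^'n" where
  "matrix_unit i j = (\<chi> k l. if k = i \<and> l = j then 1 else 0)"

lemma matrix_adj_matrix_unit [simp]: "matrix_adj (matrix_unit i j) = matrix_unit j i"
  by (auto simp: matrix_adj_def matrix_unit_def map_matrix_def transpose_def vec_eq_iff)

lemma matrix_adj_involutive [simp]: "matrix_adj (matrix_adj a) = a"
  by (simp add: matrix_adj_def map_matrix_def transpose_def vec_eq_iff)

lemma matrix_mult_matrix_unit_nth: "(a ** matrix_unit i j) $ k $ l = (if l = j then a $ k $ i else 0)"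
proof -
  have "(\<Sum>m\<in>UNIV. a $ k $ m * (if m = i \<and> l = j then 1 else 0)) =
      (\<Sum>m\<in>UNIV. if m = i then (if l = j then a $ k $ i else 0) else 0)"
    by (intro sum.cong) auto
  then show ?thesis
    by (simp add: matrix_matrix_mult_def matrix_unit_def)
qed

lemma matrix_unit_mult:
  "matrix_unit i j ** matrix_unit k l = (if j = k then matrix_unit i l else 0)"
  by (auto simp: vec_eq_iff matrix_mult_matrix_unit_nth) (auto simp: matrix_unit_def)

text \<open>Stated for functionals because operators are meaningful on the carrier only; it is
  applied to the functionals \<open>\<lambda>a. \<llangle>y, \<phi> a x\<rrangle>\<close>.\<close>

lemma additive_matrix_expand:
  fixes f :: "complex^'n^'n \<Rightarrow> complex"
  assumes add: "\<And>a b. f (a + b) = f a + f b"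
    and scale: "\<And>c a. f (matrix_cscale c a) = c * f a"
  shows "f a = (\<Sum>i\<in>UNIV. \<Sum>j\<in>UNIV. a $ i $ j * f (matrix_unit i j))"
proof -
  interpret additive f by unfold_locales (rule add)
  have inner: "(\<Sum>j\<in>UNIV. a $ i $ j * (if k = i \<and> l = j then 1 else 0)) = (if k = i then a $ k $ l else 0)"
    for i k l
  proof -
    have "(\<Sum>j\<in>UNIV. a $ i $ j * (if k = i \<and> l = j then 1 else 0)) =
        (\<Sum>j\<in>UNIV. if j = l then (if k = i then a $ k $ l else 0) else 0)"
      by (intro sum.cong) auto
    then show ?thesis by simp
  qed
  have "a = (\<Sum>i\<in>UNIV. \<Sum>j\<in>UNIV. matrix_cscale (a $ i $ j) (matrix_unit i j))"
    by (simp add: vec_eq_iff matrix_cscale_def map_matrix_def matrix_unit_def inner)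
  then have "f a = f (\<Sum>i\<in>UNIV. \<Sum>j\<in>UNIV. matrix_cscale (a $ i $ j) (matrix_unit i j))"
    by (rule arg_cong)
  then show ?thesis
    by (simp add: sum scale)
qed

lemma (in inner_product_space) linear_into_ops_expand:
  fixes \<phi> :: "complex^'n^'n \<Rightarrow> 'a \<Rightarrow> 'a"
  assumes \<phi>: "linear_into_ops H \<phi>" and x: "x \<in> carrier H" and y: "y \<in> carrier H"
  shows "\<llangle>y, \<phi> a x\<rrangle> = (\<Sum>i\<in>UNIV. \<Sum>j\<in>UNIV. a $ i $ j * \<llangle>y, \<phi> (matrix_unit i j) x\<rrangle>)"
proof (rule additive_matrix_expand)
  have closed: "\<phi> a x \<in> carrier H" for a
    using \<phi> unfolding linear_into_ops_def by (auto intro: bounded_opsD(1)[OF _ x])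
  have add: "\<And>a b. \<phi> (a + b) x = \<phi> a x \<oplus> \<phi> b x"
    and scale: "\<And>c a. \<phi> (matrix_cscale c a) x = c \<odot> \<phi> a x"
    using \<phi> x unfolding linear_into_ops_def by metis+
  show "\<llangle>y, \<phi> (a + b) x\<rrangle> = \<llangle>y, \<phi> a x\<rrangle> + \<llangle>y, \<phi> b x\<rrangle>" for a b
    unfolding add using y closed by (simp add: cinner_add_right)
  show "\<llangle>y, \<phi> (matrix_cscale c a) x\<rrangle> = c * \<llangle>y, \<phi> a x\<rrangle>" for a c
    unfolding scale using y closed by (simp add: cinner_smult_right)
qed

section \<open>Quasi-reflections\<close>

context inner_product_space
begin

text \<open>If the \<open>d i\<close> are orthogonal with common squared norm \<open>D\<close>, this
  multiplies their span by \<open>1 - c * D\<close> and fixes its complement. For nonzero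
  \<open>D\<close>, the case \<open>c = 2 / D\<close> is the ordinary reflection.\<close>

definition quasi_reflection :: "complex \<Rightarrow> ('b::finite \<Rightarrow> 'a) \<Rightarrow> 'a \<Rightarrow> 'a" where
  "quasi_reflection c d z = z \<oplus> (\<Oplus>i\<in>UNIV. (- c * \<llangle>d i, z\<rrangle>) \<odot> d i)"

context
  fixes d :: "'b::finite \<Rightarrow> 'a"
  assumes d: "\<And>i. d i \<in> carrier H"
begin

lemma quasi_reflection_in_carrier:
  assumes "z \<in> carrier H"
  shows "quasi_reflection c d z \<in> carrier H"
proof -
  have "(\<Oplus>i\<in>UNIV. (- c * \<llangle>d i, z\<rrangle>) \<odot> d i) \<in> carrier H"
    by (rule M.finsum_closed) (simp add: d)
  then show ?thesis
    using assms unfolding quasi_reflection_def by simp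
qed

lemma cinner_quasi_reflection_right:
  assumes y: "y \<in> carrier H" and z: "z \<in> carrier H"
  shows "\<llangle>y, quasi_reflection c d z\<rrangle> = \<llangle>y, z\<rrangle> - c * (\<Sum>i\<in>UNIV. \<llangle>y, d i\<rrangle> * \<llangle>d i, z\<rrangle>)"
proof -
  have f: "(\<lambda>i. (- c * \<llangle>d i, z\<rrangle>) \<odot> d i) \<in> UNIV \<rightarrow> carrier H" by (simp add: d)
  have "\<llangle>y, (\<Oplus>i\<in>UNIV. (- c * \<llangle>d i, z\<rrangle>) \<odot> d i)\<rrangle> = (\<Sum>i\<in>UNIV. - (c * (\<llangle>y, d i\<rrangle> * \<llangle>d i, z\<rrangle>)))"
    unfolding cinner_finsum_right[OF f y]
    by (intro sum.cong) (simp_all add: cinner_smult_right d y)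
  then show ?thesis
    using M.finsum_closed[OF f] y z
    by (simp add: quasi_reflection_def cinner_add_right sum_negf sum_distrib_left)
qed

lemma cinner_quasi_reflection_left:
  assumes y: "y \<in> carrier H" and z: "z \<in> carrier H"
  shows "\<llangle>quasi_reflection c d y, z\<rrangle> = \<llangle>y, z\<rrangle> - cnj c * (\<Sum>i\<in>UNIV. \<llangle>y, d i\<rrangle> * \<llangle>d i, z\<rrangle>)"
proof -
  have swap: "(\<Sum>i\<in>UNIV. cnj \<llangle>z, d i\<rrangle> * cnj \<llangle>d i, y\<rrangle>) = (\<Sum>i\<in>UNIV. \<llangle>y, d i\<rrangle> * \<llangle>d i, z\<rrangle>)"
    using cinner_commute[OF z d] cinner_commute[OF d y] by (simp add: mult.commute)
  have "\<llangle>quasi_reflection c d y, z\<rrangle> = cnj \<llangle>z, quasi_reflection c d y\<rrangle>"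
    by (rule cinner_commute[OF z quasi_reflection_in_carrier[OF y]])
  also have "\<dots> = cnj \<llangle>z, y\<rrangle> - cnj c * (\<Sum>i\<in>UNIV. cnj \<llangle>z, d i\<rrangle> * cnj \<llangle>d i, y\<rrangle>)"
    by (simp add: cinner_quasi_reflection_right[OF z y])
  finally show ?thesis
    unfolding swap cinner_commute[OF z y] .
qed

text \<open>For nonzero \<open>D\<close> the condition on \<open>c\<close> says that
  \<open>1 - c * D\<close> has modulus one. The adjoint is the quasi-reflection with coefficient
  \<open>cnj c\<close>, and the condition makes it the inverse as well.\<close>

lemma quasi_reflection_isometric_iso:
  assumes orth: "\<And>i j. \<llangle>d i, d j\<rrangle> = (if i = j then D else 0)"
    and c: "c + cnj c = c * cnj c * D"
  shows "isometric_iso H H (quasi_reflection c d)"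
proof -
  have sum_orth: "(\<Sum>j\<in>UNIV. \<llangle>d i, d j\<rrangle> * \<llangle>d j, y\<rrangle>) = D * \<llangle>d i, y\<rrangle>" for i y
  proof -
    have "(\<Sum>j\<in>UNIV. \<llangle>d i, d j\<rrangle> * \<llangle>d j, y\<rrangle>) = (\<Sum>j\<in>UNIV. if j = i then D * \<llangle>d i, y\<rrangle> else 0)"
      by (intro sum.cong) (auto simp: orth)
    then show ?thesis by simp
  qed
  \<comment> \<open>Composing coefficients \<open>b\<close> and \<open>b'\<close> yields the
    quasi-reflection with coefficient \<open>b + b' - b * b' * D\<close>, which vanishes
    here.\<close>
  have comp: "\<llangle>y, quasi_reflection b d (quasi_reflection b' d z)\<rrangle> = \<llangle>y, z\<rrangle>"
    if y: "y \<in> carrier H" and z: "z \<in> carrier H" and b: "b + b' = b * b' * D" for y z b b'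
  proof -
    define s where "s = (\<Sum>i\<in>UNIV. \<llangle>y, d i\<rrangle> * \<llangle>d i, z\<rrangle>)"
    have t: "(\<Sum>i\<in>UNIV. \<llangle>y, d i\<rrangle> * \<llangle>d i, quasi_reflection b' d z\<rrangle>) = (1 - b' * D) * s"
      unfolding cinner_quasi_reflection_right[OF d z] sum_orth s_def sum_distrib_left
      by (intro sum.cong) (simp_all add: algebra_simps)
    have "\<llangle>y, quasi_reflection b d (quasi_reflection b' d z)\<rrangle> = \<llangle>y, z\<rrangle> - (b + b' - b * b' * D) * s"
      unfolding cinner_quasi_reflection_right[OF y quasi_reflection_in_carrier[OF z]]
        cinner_quasi_reflection_right[OF y z] s_def[symmetric] t
      by (simp add: algebra_simps)
    then show ?thesis by (simp add: b)
  qed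
  have "\<llangle>quasi_reflection c d y, quasi_reflection c d z\<rrangle> = \<llangle>y, z\<rrangle>"
    if y: "y \<in> carrier H" and z: "z \<in> carrier H" for y z
  proof -
    have "\<llangle>quasi_reflection c d y, quasi_reflection c d z\<rrangle> =
        \<llangle>y, quasi_reflection (cnj c) d (quasi_reflection c d z)\<rrangle>"
      by (simp add: cinner_quasi_reflection_left cinner_quasi_reflection_right y
          quasi_reflection_in_carrier[OF z])
    then show ?thesis
      using comp[OF y z, of "cnj c" c] c by (simp add: ac_simps)
  qed
  moreover have "quasi_reflection c d ` carrier H = carrier H"
  proof
    show "quasi_reflection c d ` carrier H \<subseteq> carrier H"
      using quasi_reflection_in_carrier by blast
    show "carrier H \<subseteq> quasi_reflection c d ` carrier H"
    proof
      fix z assume z: "z \<in> carrier H"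
      have "z = quasi_reflection c d (quasi_reflection (cnj c) d z)"
        by (rule cinner_eqI) (simp_all add: z quasi_reflection_in_carrier comp c)
      then show "z \<in> quasi_reflection c d ` carrier H"
        using quasi_reflection_in_carrier[OF z] by (rule image_eqI)
    qed
  qed
  ultimately show ?thesis
    unfolding isometric_iso_def by blast
qed

end

end

section \<open>Finite-dimensional representations\<close>

locale fin_dim_rep = inner_product_space H for H :: "'a cinner_space" (structure) +
  fixes \<pi> :: "complex^'n^'n \<Rightarrow> 'a \<Rightarrow> 'a"
  assumes fin_dim: "fin_dim H" and rep: "unital_star_hom H \<pi>"
begin

lemma rep_linear: "linear_into_ops H \<pi>"
  using rep unfolding unital_star_hom_def by (rule conjunct1)

lemma rep_bounded: "\<pi> a \<in> bounded_ops H H"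
  using rep_linear unfolding linear_into_ops_def by simp

lemma rep_in_carrier [simp]: "x \<in> carrier H \<Longrightarrow> \<pi> a x \<in> carrier H"
  by (rule bounded_opsD(1)[OF rep_bounded])

lemma rep_mult: "x \<in> carrier H \<Longrightarrow> \<pi> a (\<pi> b x) = \<pi> (a ** b) x"
  using rep unfolding unital_star_hom_def by metis

lemma rep_zero: "x \<in> carrier H \<Longrightarrow> \<pi> 0 x = \<zero>"
proof -
  assume x: "x \<in> carrier H"
  have "matrix_cscale 0 (0 :: complex^'n^'n) = 0"
    by (simp add: matrix_cscale_def map_matrix_def vec_eq_iff)
  then have "\<pi> 0 x = \<pi> (matrix_cscale 0 0) x"
    by simp
  also have "\<dots> = 0 \<odot> \<pi> 0 x"
    using rep_linear x unfolding linear_into_ops_def by blast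
  also have "\<dots> = \<zero>"
    using smult_l_null[OF rep_in_carrier[OF x]] by simp
  finally show ?thesis .
qed

lemma cinner_rep_left:
  assumes "x \<in> carrier H" "y \<in> carrier H"
  shows "\<llangle>\<pi> a x, y\<rrangle> = \<llangle>x, \<pi> (matrix_adj a) y\<rrangle>"
proof -
  interpret inner_product_space_pair H H by unfold_locales
  have "\<pi> (matrix_adj (matrix_adj a)) x = adj H H (\<pi> (matrix_adj a)) x"
    using rep assms unfolding unital_star_hom_def by blast
  then show ?thesis
    using adj(2)[OF fin_dim rep_bounded assms, of "matrix_adj a"] by simp
qed

text \<open>Unitality enters here: a vector is recovered from its images under the diagonal matrix
  units.\<close>

lemma cinner_rep_one:
  assumes x: "x \<in> carrier H" and y: "y \<in> carrier H"
  shows "\<llangle>y, x\<rrangle> = (\<Sum>i\<in>UNIV. \<llangle>y, \<pi> (matrix_unit i i) x\<rrangle>)"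
proof -
  have "\<pi> (mat 1) x = x"
    using rep x unfolding unital_star_hom_def by blast
  then have "\<llangle>y, x\<rrangle> = \<llangle>y, \<pi> (mat 1) x\<rrangle>"
    by simp
  also have "\<dots> = (\<Sum>i\<in>UNIV. \<Sum>j\<in>UNIV. mat 1 $ i $ j * \<llangle>y, \<pi> (matrix_unit i j) x\<rrangle>)"
    by (rule linear_into_ops_expand[OF rep_linear x y])
  also have "\<dots> = (\<Sum>i\<in>UNIV. \<llangle>y, \<pi> (matrix_unit i i) x\<rrangle>)"
    by (simp add: mat_def if_distrib[where f = "\<lambda>c. c * _"] cong: if_cong)
  finally show ?thesis .
qed

text \<open>Moving the first matrix unit to the right gives
  \<open>matrix_unit k i ** matrix_unit j k\<close>, which is \<open>matrix_unit k k\<close> or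
  zero. For \<open>x = y\<close> it yields an orthogonal family of vectors of equal norm, as
  quasi-reflections require.\<close>

lemma cinner_rep_matrix_unit:
  assumes x: "x \<in> carrier H" and y: "y \<in> carrier H" and "\<pi> (matrix_unit k k) y = y"
  shows "\<llangle>\<pi> (matrix_unit i k) x, \<pi> (matrix_unit j k) y\<rrangle> = (if i = j then \<llangle>x, y\<rrangle> else 0)"
  using x y assms(3) by (simp add: cinner_rep_left rep_mult matrix_unit_mult rep_zero)

text \<open>
  For fixed \<open>k\<close>, the vectors \<open>\<pi> (matrix_unit i k) x\<close> transform under \<open>\<pi>\<close> like the standard basis,
  which is why a quasi-reflection along all of them at once commutes with \<open>\<pi>\<close>.
\<close>

lemma quasi_reflection_rep:
  fixes k :: 'n
  assumes x: "x \<in> carrier H" and z: "z \<in> carrier H"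
  defines "d \<equiv> (\<lambda>i. \<pi> (matrix_unit i k) x)"
  shows "quasi_reflection c d (\<pi> a z) = \<pi> a (quasi_reflection c d z)"
proof -
  have d: "d i \<in> carrier H" for i
    using x by (simp add: d_def)
  note closed = quasi_reflection_in_carrier[of d, OF d]
  \<comment> \<open>The product \<open>b ** matrix_unit i k\<close> is the combination of the
    \<open>matrix_unit j k\<close> with coefficients \<open>b $ j $ i\<close>.\<close>
  have rep_d: "\<llangle>y, \<pi> b (d i)\<rrangle> = (\<Sum>j\<in>UNIV. b $ j $ i * \<llangle>y, d j\<rrangle>)" if y: "y \<in> carrier H" for y b i
  proof -
    have "\<llangle>y, \<pi> b (d i)\<rrangle> = \<llangle>y, \<pi> (b ** matrix_unit i k) x\<rrangle>"
      using x by (simp add: d_def rep_mult)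
    also have "\<dots> = (\<Sum>j\<in>UNIV. \<Sum>l\<in>UNIV. if l = k then b $ j $ i * \<llangle>y, d j\<rrangle> else 0)"
      by (subst linear_into_ops_expand[OF rep_linear x y], intro sum.cong) (auto simp: matrix_mult_matrix_unit_nth d_def)
    finally show ?thesis by simp
  qed
  have rep_adj: "\<llangle>\<pi> (matrix_adj b) y, u\<rrangle> = \<llangle>y, \<pi> b u\<rrangle>" if "y \<in> carrier H" "u \<in> carrier H" for y u b
    using that by (simp add: cinner_rep_left)
  have d_rep: "\<llangle>d i, \<pi> a z\<rrangle> = (\<Sum>j\<in>UNIV. a $ i $ j * \<llangle>d j, z\<rrangle>)" for i
  proof -
    have "\<llangle>d i, \<pi> a z\<rrangle> = cnj \<llangle>z, \<pi> (matrix_adj a) (d i)\<rrangle>"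
      unfolding rep_adj[OF d z, symmetric] by (rule cinner_commute[OF z rep_in_carrier[OF d]])
    also have "\<dots> = (\<Sum>j\<in>UNIV. a $ i $ j * cnj \<llangle>z, d j\<rrangle>)"
      by (simp add: rep_d[OF z] matrix_adj_def map_matrix_def transpose_def)
    finally show ?thesis
      using cinner_commute[OF z d] by simp
  qed
  show ?thesis
  proof (rule cinner_eqI)
    fix y assume y: "y \<in> carrier H"
    have "\<llangle>y, \<pi> a (quasi_reflection c d z)\<rrangle> = \<llangle>\<pi> (matrix_adj a) y, quasi_reflection c d z\<rrangle>"
      using y z closed rep_adj by simp
    also have "\<dots> = \<llangle>y, \<pi> a z\<rrangle> - c * (\<Sum>j\<in>UNIV. \<llangle>y, \<pi> a (d j)\<rrangle> * \<llangle>d j, z\<rrangle>)"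
      using y z d by (simp add: cinner_quasi_reflection_right rep_adj)
    also have "(\<Sum>j\<in>UNIV. \<llangle>y, \<pi> a (d j)\<rrangle> * \<llangle>d j, z\<rrangle>) = (\<Sum>j\<in>UNIV. \<Sum>i\<in>UNIV. \<llangle>y, d i\<rrangle> * (a $ i $ j * \<llangle>d j, z\<rrangle>))"
      unfolding rep_d[OF y] sum_distrib_right by (intro sum.cong refl) (simp add: mult_ac)
    also have "\<dots> = (\<Sum>i\<in>UNIV. \<llangle>y, d i\<rrangle> * \<llangle>d i, \<pi> a z\<rrangle>)"
      unfolding d_rep sum_distrib_left by (rule sum.swap)
    also have "\<llangle>y, \<pi> a z\<rrangle> - c * \<dots> = \<llangle>y, quasi_reflection c d (\<pi> a z)\<rrangle>"
      using y z d by (simp add: cinner_quasi_reflection_right)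
    finally show "\<llangle>y, quasi_reflection c d (\<pi> a z)\<rrangle> = \<llangle>y, \<pi> a (quasi_reflection c d z)\<rrangle>" ..
  qed (simp_all add: closed z)
qed

end

section \<open>Uniqueness of purifications\<close>

locale fin_dim_rep_pair = H: fin_dim_rep H \<pi> + I: fin_dim_rep I \<rho>
  for H :: "'a cinner_space" and \<pi> :: "complex^'n^'n \<Rightarrow> 'a \<Rightarrow> 'a"
    and I :: "'b cinner_space" and \<rho> :: "complex^'n^'n \<Rightarrow> 'b \<Rightarrow> 'b"
begin

definition intertwining_iso :: "('a \<Rightarrow> 'b) \<Rightarrow> bool" where
  "intertwining_iso U \<longleftrightarrow>
     isometric_iso H I U \<and> (\<forall>a. \<forall>x\<in>carrier H. U (\<pi> a x) = \<rho> a (U x))"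

text \<open>
  The family is moved one vector at a time. If \<open>U\<close> is already correct on \<open>T\<close> and maps the next
  vector to \<open>p\<close> instead of \<open>q\<close>, then \<open>p - q\<close> is orthogonal to all \<open>w t\<close> with \<open>t \<in> T\<close>, so a
  quasi-reflection along \<open>p - q\<close> that sends \<open>p\<close> to \<open>q\<close> leaves them fixed.
\<close>

lemma intertwining_iso_extending_isometry:
  fixes k :: 'n and v :: "'t \<Rightarrow> 'a" and w :: "'t \<Rightarrow> 'b"
  assumes S: "intertwining_iso S" and "finite T"
    and "\<forall>t\<in>T. v t \<in> carrier H \<and> \<pi> (matrix_unit k k) (v t) = v t"
    and "\<forall>t\<in>T. w t \<in> carrier I \<and> \<rho> (matrix_unit k k) (w t) = w t"
    and "\<forall>s\<in>T. \<forall>t\<in>T. \<llangle>w s, w t\<rrangle>\<^bsub>I\<^esub> = \<llangle>v s, v t\<rrangle>\<^bsub>H\<^esub>"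
  shows "\<exists>U. intertwining_iso U \<and> (\<forall>t\<in>T. U (v t) = w t)"
  using assms(2-5)
proof (induction T)
  case empty
  then show ?case using S by blast
next
  case (insert t0 T)
  then obtain U where U: "intertwining_iso U" and Ut: "\<forall>t\<in>T. U (v t) = w t"
    by auto
  have v: "v t \<in> carrier H" "\<pi> (matrix_unit k k) (v t) = v t" if "t \<in> insert t0 T" for t
    using insert.prems(1) that by blast+
  have w: "w t \<in> carrier I" "\<rho> (matrix_unit k k) (w t) = w t" if "t \<in> insert t0 T" for t
    using insert.prems(2) that by blast+
  have gram: "\<llangle>w s, w t\<rrangle>\<^bsub>I\<^esub> = \<llangle>v s, v t\<rrangle>\<^bsub>H\<^esub>" if "s \<in> insert t0 T" "t \<in> insert t0 T" for s t
    using insert.prems(3) that by blast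
  have iso: "isometric_iso H I U"
    and inter: "\<And>a x. x \<in> carrier H \<Longrightarrow> U (\<pi> a x) = \<rho> a (U x)"
    using U unfolding intertwining_iso_def by blast+
  define p where "p = U (v t0)"
  define q where "q = w t0"
  have p: "p \<in> carrier I"
    unfolding p_def by (rule isometric_iso_in_carrier[OF iso v(1)]) simp
  have q: "q \<in> carrier I" "\<rho> (matrix_unit k k) q = q"
    using w[of t0] by (simp_all add: q_def)
  \<comment> \<open>Intertwiners respect the ranges of \<open>matrix_unit k k\<close>, so the
    induction never leaves the multiplicity space.\<close>
  have pk: "\<rho> (matrix_unit k k) p = p"
    unfolding p_def using inter[OF v(1), of t0 "matrix_unit k k"] v(2)[of t0] by simp
  have pw: "\<llangle>p, w t\<rrangle>\<^bsub>I\<^esub> = \<llangle>q, w t\<rrangle>\<^bsub>I\<^esub>" if t: "t \<in> T" for t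
  proof -
    have "\<llangle>p, U (v t)\<rrangle>\<^bsub>I\<^esub> = \<llangle>q, w t\<rrangle>\<^bsub>I\<^esub>"
      unfolding p_def q_def using t by (simp add: isometric_iso_cinner[OF iso] v gram)
    then show ?thesis
      using Ut t by simp
  qed
  have pp: "\<llangle>p, p\<rrangle>\<^bsub>I\<^esub> = \<llangle>q, q\<rrangle>\<^bsub>I\<^esub>"
    unfolding p_def q_def using gram[of t0 t0] by (simp add: isometric_iso_cinner[OF iso] v)
  show ?case
  proof (cases "p = q")
    case True
    then show ?thesis
      using U Ut unfolding p_def q_def by (intro exI[of _ U]) simp
  next
    case False
    define d where "d = p \<ominus>\<^bsub>I\<^esub> q"
    define e where "e = (\<lambda>i. \<rho> (matrix_unit i k) d)"
    define D where "D = \<llangle>d, d\<rrangle>\<^bsub>I\<^esub>"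
    define \<alpha> where "\<alpha> = \<llangle>d, p\<rrangle>\<^bsub>I\<^esub>"
    have d: "d \<in> carrier I" unfolding d_def using p q by simp
    have e: "e i \<in> carrier I" for i unfolding e_def using d by simp
    have dk: "\<rho> (matrix_unit k k) d = d"
    proof (rule I.cinner_eqI)
      fix z assume z: "z \<in> carrier I"
      have "\<llangle>z, \<rho> (matrix_unit k k) d\<rrangle>\<^bsub>I\<^esub> = \<llangle>\<rho> (matrix_unit k k) z, p \<ominus>\<^bsub>I\<^esub> q\<rrangle>\<^bsub>I\<^esub>"
        using z d by (simp add: I.cinner_rep_left d_def)
      also have "\<dots> = \<llangle>z, \<rho> (matrix_unit k k) p\<rrangle>\<^bsub>I\<^esub> - \<llangle>z, \<rho> (matrix_unit k k) q\<rrangle>\<^bsub>I\<^esub>"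
        using z p q(1) by (simp add: I.cinner_rep_left I.cinner_minus_right)
      also have "\<dots> = \<llangle>z, d\<rrangle>\<^bsub>I\<^esub>"
        unfolding pk q(2) d_def using z p q(1) by (simp add: I.cinner_minus_right)
      finally show "\<llangle>z, \<rho> (matrix_unit k k) d\<rrangle>\<^bsub>I\<^esub> = \<llangle>z, d\<rrangle>\<^bsub>I\<^esub>" .
    qed (use d in simp_all)
    have orth: "\<llangle>e i, e j\<rrangle>\<^bsub>I\<^esub> = (if i = j then D else 0)" for i j
      unfolding e_def D_def by (rule I.cinner_rep_matrix_unit[OF d d dk])
    have ex: "\<llangle>e i, x\<rrangle>\<^bsub>I\<^esub> = (if i = k then \<llangle>d, x\<rrangle>\<^bsub>I\<^esub> else 0)"
      if x: "x \<in> carrier I" "\<rho> (matrix_unit k k) x = x" for i x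
      using I.cinner_rep_matrix_unit[OF d x, of i k] unfolding x(2) e_def .
    \<comment> \<open>This is where equality of the norms of \<open>p\<close> and \<open>q\<close>
      is used. It makes the real part of \<open>\<alpha>\<close> equal to half of \<open>D\<close>,
      so \<open>\<alpha>\<close> is invertible.\<close>
    have D: "D = \<alpha> + cnj \<alpha>"
    proof -
      have "cnj \<alpha> = \<llangle>p, d\<rrangle>\<^bsub>I\<^esub>"
        unfolding \<alpha>_def by (rule I.cinner_commute[OF d p, symmetric])
      then show ?thesis
        unfolding D_def \<alpha>_def d_def using p q(1) pp
        by (simp add: I.cinner_minus_left I.cinner_minus_right)
    qed
    have "d \<noteq> \<zero>\<^bsub>I\<^esub>"
      using False I.minus_eq_zeroD[OF p q(1)] unfolding d_def by blast
    then have "D \<noteq> 0"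
      unfolding D_def using I.cinner_self_eq_0[OF d] by simp
    then have \<alpha>: "\<alpha> \<noteq> 0"
      using D by auto
    \<comment> \<open>The coefficient is forced by \<open>R p = p - d = q\<close>, as
      \<open>\<llangle>d, p\<rrangle>\<close> is \<open>\<alpha>\<close>. The isometry condition
      then becomes exactly \<open>D = \<alpha> + cnj \<alpha>\<close>.\<close>
    define R where "R = I.quasi_reflection (1 / \<alpha>) e"
    have R: "isometric_iso I I R"
      unfolding R_def
      by (rule I.quasi_reflection_isometric_iso[OF e orth]) (use \<alpha> in \<open>simp add: D field_simps\<close>)
    \<comment> \<open>On the multiplicity space only \<open>e k = d\<close> contributes; the other
      \<open>e i\<close> are there to make \<open>R\<close> commute with
      \<open>\<rho>\<close>.\<close>
    have zR: "\<llangle>z, R x\<rrangle>\<^bsub>I\<^esub> = \<llangle>z, x\<rrangle>\<^bsub>I\<^esub> - 1 / \<alpha> * (\<llangle>z, d\<rrangle>\<^bsub>I\<^esub> * \<llangle>d, x\<rrangle>\<^bsub>I\<^esub>)"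
      if z: "z \<in> carrier I" and x: "x \<in> carrier I" "\<rho> (matrix_unit k k) x = x" for z x
    proof -
      have "(\<Sum>i\<in>UNIV. \<llangle>z, e i\<rrangle>\<^bsub>I\<^esub> * \<llangle>e i, x\<rrangle>\<^bsub>I\<^esub>) = (\<Sum>i\<in>UNIV. if i = k then \<llangle>z, d\<rrangle>\<^bsub>I\<^esub> * \<llangle>d, x\<rrangle>\<^bsub>I\<^esub> else 0)"
        by (intro sum.cong) (auto simp: ex[OF x], simp add: e_def dk)
      then show ?thesis
        unfolding R_def I.cinner_quasi_reflection_right[OF e z x(1)] by simp
    qed
    have Rp: "R p = q"
    proof (rule I.cinner_eqI)
      fix z assume z: "z \<in> carrier I"
      have "\<llangle>z, R p\<rrangle>\<^bsub>I\<^esub> = \<llangle>z, p\<rrangle>\<^bsub>I\<^esub> - \<llangle>z, d\<rrangle>\<^bsub>I\<^esub>"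
        unfolding zR[OF z p pk] using \<alpha> by (simp add: \<alpha>_def)
      then show "\<llangle>z, R p\<rrangle>\<^bsub>I\<^esub> = \<llangle>z, q\<rrangle>\<^bsub>I\<^esub>"
        using z p q(1) by (simp add: d_def I.cinner_minus_right)
    qed (use q(1) isometric_iso_in_carrier[OF R p] in simp_all)
    have Rw: "R (w t) = w t" if t: "t \<in> T" for t
    proof (rule I.cinner_eqI)
      have wt: "w t \<in> carrier I" "\<rho> (matrix_unit k k) (w t) = w t"
        using w t by auto
      have "\<llangle>d, w t\<rrangle>\<^bsub>I\<^esub> = 0"
        unfolding d_def using pw[OF t] p q(1) wt(1) by (simp add: I.cinner_minus_left)
      then show "\<llangle>z, R (w t)\<rrangle>\<^bsub>I\<^esub> = \<llangle>z, w t\<rrangle>\<^bsub>I\<^esub>" if "z \<in> carrier I" for z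
        by (simp add: zR[OF that wt])
      show "w t \<in> carrier I" "R (w t) \<in> carrier I"
        using wt(1) isometric_iso_in_carrier[OF R wt(1)] by simp_all
    qed
    have "intertwining_iso (\<lambda>x. R (U x))"
      unfolding intertwining_iso_def
    proof (intro conjI allI ballI)
      show "isometric_iso H I (\<lambda>x. R (U x))"
        by (rule isometric_iso_comp[OF iso R])
      fix a x assume x: "x \<in> carrier H"
      show "R (U (\<pi> a x)) = \<rho> a (R (U x))"
        unfolding inter[OF x] R_def e_def
        by (rule I.quasi_reflection_rep[OF d isometric_iso_in_carrier[OF iso x]])
    qed
    moreover have "\<forall>t\<in>insert t0 T. R (U (v t)) = w t"
      using Rp Rw Ut unfolding p_def q_def by simp
    ultimately show ?thesis by blast
  qed
qed

end

lemma purification_cinner: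
  assumes K: "inner_product_space K" "fin_dim K" and P: "purification \<phi> K H \<pi> V" and H: "fin_dim_rep H \<pi>"
    and x: "x \<in> carrier K" and y: "y \<in> carrier K"
  shows "\<llangle>\<pi> a (V x), V y\<rrangle>\<^bsub>H\<^esub> = \<llangle>\<phi> a x, y\<rrangle>\<^bsub>K\<^esub>"
proof -
  interpret H: fin_dim_rep H \<pi> by (rule H)
  interpret K: inner_product_space K by (rule K(1))
  interpret inner_product_space_pair K H by unfold_locales
  have V: "V \<in> bounded_ops K H" and "adj K H V (\<pi> a (V x)) = \<phi> a x"
    using P x unfolding purification_def by blast+
  then show ?thesis
    using adj(2)[OF K(2) V H.rep_in_carrier[OF bounded_opsD(1)[OF V x]] y, of a] by simp
qed

theorem purification_unique:
  fixes \<phi> :: "complex^'n^'n \<Rightarrow> 'k \<Rightarrow> 'k"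
  assumes K: "inner_product_space K" "fin_dim K"
    and P: "purification \<phi> K H \<pi> V" "fin_dim H"
    and Q: "purification \<phi> K I \<rho> W" "fin_dim I"
    and equiv: "unitarily_equivalent H \<pi> I \<rho>"
  shows "\<exists>U. unitary_intertwiner H \<pi> I \<rho> U \<and> (\<forall>x\<in>carrier K. U (V x) = W x)"
proof -
  have H: "fin_dim_rep H \<pi>" and I: "fin_dim_rep I \<rho>"
    using P Q unfolding purification_def fin_dim_rep_def fin_dim_rep_axioms_def hilbert_space_def
    by blast+
  interpret H: fin_dim_rep H \<pi> by (rule H)
  interpret I: fin_dim_rep I \<rho> by (rule I)
  interpret K: inner_product_space K by (rule K(1))
  interpret fin_dim_rep_pair H \<pi> I \<rho> by unfold_locales
  interpret HI: inner_product_space_pair H I by unfold_locales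
  interpret KH: inner_product_space_pair K H by unfold_locales
  interpret KI: inner_product_space_pair K I by unfold_locales
  have V: "V \<in> bounded_ops K H" and W: "W \<in> bounded_ops K I"
    using P Q unfolding purification_def by blast+
  note Vc = bounded_opsD(1)[OF V] and Wc = bounded_opsD(1)[OF W]
  obtain S where S: "unitary_op H I S" "\<forall>a. \<forall>x\<in>carrier H. S (\<pi> a x) = \<rho> a (S x)"
    using equiv unfolding unitarily_equivalent_def unitary_intertwiner_def by blast
  have S: "intertwining_iso S"
    unfolding intertwining_iso_def using HI.unitary_op_isometric_iso[OF P(2) S(1)] S(2) by blast
  obtain E where E: "K.orthonormal_basis E"
    using K.fin_dim_orthonormal_basis[OF K(2)] .
  then have EK: "finite E" "E \<subseteq> carrier K"
    unfolding K.orthonormal_basis_def by blast+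
  \<comment> \<open>An arbitrary index, whose matrix unit selects the multiplicity space.\<close>
  obtain k :: 'n where True by blast
  define v where "v = (\<lambda>(i, x). \<pi> (matrix_unit k i) (V x))"
  define w where "w = (\<lambda>(i, x). \<rho> (matrix_unit k i) (W x))"
  \<comment> \<open>The index \<open>k\<close> cancels in
    \<open>matrix_unit i k ** matrix_unit k j\<close>, and what is left is an entry of
    \<open>\<phi>\<close>.\<close>
  have gram: "\<llangle>w s, w t\<rrangle>\<^bsub>I\<^esub> = \<llangle>v s, v t\<rrangle>\<^bsub>H\<^esub>" if "s \<in> UNIV \<times> E" "t \<in> UNIV \<times> E" for s t
  proof -
    obtain i x j y where st: "s = (i, x)" "t = (j, y)" and xy: "x \<in> carrier K" "y \<in> carrier K"
      using \<open>s \<in> UNIV \<times> E\<close> \<open>t \<in> UNIV \<times> E\<close> EK by (cases s; cases t) auto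
    have "\<llangle>v s, v t\<rrangle>\<^bsub>H\<^esub> = \<llangle>\<phi> (matrix_unit j i) x, y\<rrangle>\<^bsub>K\<^esub>"
      unfolding purification_cinner[OF K P(1) H xy, symmetric] st v_def
      using xy by (simp add: H.cinner_rep_left H.rep_mult matrix_unit_mult Vc)
    moreover have "\<llangle>w s, w t\<rrangle>\<^bsub>I\<^esub> = \<llangle>\<phi> (matrix_unit j i) x, y\<rrangle>\<^bsub>K\<^esub>"
      unfolding purification_cinner[OF K Q(1) I xy, symmetric] st w_def
      using xy by (simp add: I.cinner_rep_left I.rep_mult matrix_unit_mult Wc)
    ultimately show ?thesis by simp
  qed
  have "\<exists>U. intertwining_iso U \<and> (\<forall>t\<in>UNIV \<times> E. U (v t) = w t)"
  proof (rule intertwining_iso_extending_isometry[OF S, of _ _ k])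
    show "finite ((UNIV :: 'n set) \<times> E)" using EK by simp
    show "\<forall>s\<in>UNIV \<times> E. \<forall>t\<in>UNIV \<times> E. \<llangle>w s, w t\<rrangle>\<^bsub>I\<^esub> = \<llangle>v s, v t\<rrangle>\<^bsub>H\<^esub>"
      using gram by blast
    show "\<forall>t\<in>UNIV \<times> E. v t \<in> carrier H \<and> \<pi> (matrix_unit k k) (v t) = v t"
      using EK by (auto simp: v_def H.rep_mult matrix_unit_mult Vc subset_iff)
    show "\<forall>t\<in>UNIV \<times> E. w t \<in> carrier I \<and> \<rho> (matrix_unit k k) (w t) = w t"
      using EK by (auto simp: w_def I.rep_mult matrix_unit_mult Wc subset_iff)
  qed
  then obtain U where U: "intertwining_iso U"
    and Uv: "\<And>i x. x \<in> E \<Longrightarrow> U (\<pi> (matrix_unit k i) (V x)) = \<rho> (matrix_unit k i) (W x)"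
    unfolding v_def w_def by auto
  have iso: "isometric_iso H I U" and inter: "\<And>a x. x \<in> carrier H \<Longrightarrow> U (\<pi> a x) = \<rho> a (U x)"
    using U unfolding intertwining_iso_def by blast+
  note Uc = isometric_iso_in_carrier[OF iso]
  have UVE: "U (V x) = W x" if "x \<in> E" for x
  proof (rule I.cinner_eqI)
    have x: "x \<in> carrier K" using that EK by blast
    show "U (V x) \<in> carrier I" "W x \<in> carrier I" using x Uc Vc Wc by blast+
    fix z assume z: "z \<in> carrier I"
    \<comment> \<open>Factor \<open>matrix_unit i i\<close> through
      \<open>matrix_unit i k ** matrix_unit k i\<close>; the right factor leads to a vector on which
      \<open>U\<close> is known.\<close>
    have "\<rho> (matrix_unit i i) (U (V x)) = \<rho> (matrix_unit i i) (W x)" for i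
    proof -
      have "\<rho> (matrix_unit i i) (U (V x)) = \<rho> (matrix_unit i k) (U (\<pi> (matrix_unit k i) (V x)))"
        using x by (simp add: inter Uc Vc I.rep_mult matrix_unit_mult)
      then show ?thesis
        unfolding Uv[OF that] using x by (simp add: Wc I.rep_mult matrix_unit_mult)
    qed
    then show "\<llangle>z, U (V x)\<rrangle>\<^bsub>I\<^esub> = \<llangle>z, W x\<rrangle>\<^bsub>I\<^esub>"
      by (simp add: I.cinner_rep_one[OF Uc[OF Vc[OF x]] z] I.cinner_rep_one[OF Wc[OF x] z])
  qed
  \<comment> \<open>Needed to pass from the basis \<open>E\<close> to all of \<open>K\<close> by
    linearity.\<close>
  have UV: "(\<lambda>x. U (V x)) \<in> bounded_ops K I"
  proof -
    have "cnorm I (U (V x)) = cnorm H (V x)" if "x \<in> carrier K" for x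
      by (simp add: cnorm_def isometric_iso_cinner[OF iso] Vc that)
    then have "\<exists>C. \<forall>x\<in>carrier K. cnorm I (U (V x)) \<le> C * cnorm K x"
      using V unfolding bounded_ops_def by simp
    then show ?thesis
      unfolding bounded_ops_def using Uc Vc
      by (simp add: bounded_opsD[OF V] HI.isometric_iso_linear[OF iso] Pi_iff)
  qed
  have "U (V x) = W x" if x: "x \<in> carrier K" for x
  proof (rule I.cinner_eqI)
    show "U (V x) \<in> carrier I" "W x \<in> carrier I" using x Uc Vc Wc by blast+
    fix z assume z: "z \<in> carrier I"
    show "\<llangle>z, U (V x)\<rrangle>\<^bsub>I\<^esub> = \<llangle>z, W x\<rrangle>\<^bsub>I\<^esub>"
      unfolding KI.cinner_op_basis[OF UV E x z] KI.cinner_op_basis[OF W E x z]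
      by (intro sum.cong) (simp_all add: UVE)
  qed
  then show ?thesis
    unfolding unitary_intertwiner_def using HI.isometric_iso_unitary_op[OF iso] inter by blast
qed

section \<open>Factorization of positive semidefinite matrices\<close>

definition positive_semidefinite_on :: "'p set \<Rightarrow> ('p \<Rightarrow> 'p \<Rightarrow> complex) \<Rightarrow> bool" where
  "positive_semidefinite_on P G \<longleftrightarrow>
     (\<forall>c. (\<Sum>p\<in>P. \<Sum>q\<in>P. cnj (c p) * G p q * c q) \<in> \<real>\<^sub>\<ge>\<^sub>0)"

lemma Im_nonneg_Reals: "z \<in> \<real>\<^sub>\<ge>\<^sub>0 \<Longrightarrow> Im z = 0"
  by (simp add: complex_nonneg_Reals_iff)

text \<open>Isolates the coefficient \<open>t\<close> at the new index. The next proofs obtain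
  everything from suitable choices of \<open>t\<close>.\<close>

lemma positive_semidefinite_on_insert:
  assumes G: "positive_semidefinite_on (insert b P) G" and P: "finite P" "b \<notin> P"
  shows "cnj t * G b b * t + cnj t * (\<Sum>q\<in>P. G b q * c q) + (\<Sum>p\<in>P. cnj (c p) * G p b) * t +
    (\<Sum>p\<in>P. \<Sum>q\<in>P. cnj (c p) * G p q * c q) \<in> \<real>\<^sub>\<ge>\<^sub>0"
proof -
  let ?c = "c(b := t)"
  have c: "?c p = c p" if "p \<in> P" for p
    using that P(2) by auto
  have "(\<Sum>p\<in>insert b P. \<Sum>q\<in>insert b P. cnj (?c p) * G p q * ?c q) \<in> \<real>\<^sub>\<ge>\<^sub>0"
    using G unfolding positive_semidefinite_on_def by blast
  also have "(\<Sum>p\<in>insert b P. \<Sum>q\<in>insert b P. cnj (?c p) * G p q * ?c q) =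
      cnj t * G b b * t + (\<Sum>q\<in>P. cnj t * G b q * c q) +
      (\<Sum>p\<in>P. cnj (c p) * G p b * t + (\<Sum>q\<in>P. cnj (c p) * G p q * c q))"
    using P by (simp add: c del: fun_upd_apply add: fun_upd_same cong: sum.cong)
  finally show ?thesis
    by (simp add: sum.distrib sum_distrib_left sum_distrib_right mult.assoc add_ac)
qed

lemma positive_semidefinite_on_pair:
  assumes G: "positive_semidefinite_on (insert b P) G" and P: "finite P" "b \<notin> P" and p: "p \<in> P"
  shows "cnj t * G b b * t + cnj t * G b p + G p b * t + G p p \<in> \<real>\<^sub>\<ge>\<^sub>0"
proof -
  have delta: "(\<Sum>q\<in>P. f q * (if q = p then 1 else 0)) = f p"
    "(\<Sum>q\<in>P. cnj (if q = p then 1 else 0) * f q) = f p" for f :: "'a \<Rightarrow> complex"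
    using P(1) p by (simp_all add: if_distrib[where f = "\<lambda>x. _ * x"] if_distrib[where f = "\<lambda>x. x * _"]
        if_distrib[where f = cnj] cong: if_cong)
  show ?thesis
    using positive_semidefinite_on_insert[OF G P, of t "\<lambda>q. if q = p then 1 else 0"]
    by (simp only: delta)
qed

text \<open>A Cholesky factorization: split off the row of \<open>b\<close> and continue with the
  Schur complement. Division by zero being zero, the formulas also cover a vanishing pivot
  \<open>g\<close>, where the whole row vanishes.\<close>

lemma gram_factorization:
  assumes "finite P" "positive_semidefinite_on P G"
  shows "\<exists>(r :: nat) R. \<forall>p\<in>P. \<forall>q\<in>P. G p q = (\<Sum>l<r. cnj (R l p) * R l q)"
  using assms
proof (induction P arbitrary: G)
  case empty
  then show ?case by simp
next
  case (insert b P)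
  note ins = positive_semidefinite_on_insert[OF insert.prems insert.hyps]
    and pair = positive_semidefinite_on_pair[OF insert.prems insert.hyps]
  define g where "g = Re (G b b)"
  have Gbb: "G b b = of_real g" and g: "g \<ge> 0"
    using ins[of 1 "\<lambda>_. 0"] by (simp_all add: g_def complex_nonneg_Reals_iff complex_eq_iff)
  have Gpp: "G p p \<in> \<real>\<^sub>\<ge>\<^sub>0" if "p \<in> P" for p
    using pair[OF that, of 0] by simp
  \<comment> \<open>Only reality of the quadratic form is used: \<open>t = 1\<close> compares the
    imaginary parts and \<open>t = \<i>\<close> the real parts.\<close>
  have herm: "G p b = cnj (G b p)" if p: "p \<in> P" for p
    using Im_nonneg_Reals[OF pair[OF p, of 1]] Im_nonneg_Reals[OF pair[OF p, of \<i>]]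
      Im_nonneg_Reals[OF Gpp[OF p]]
    by (simp add: complex_eq_iff Gbb)
  have null: "G b p = 0" if p: "p \<in> P" and "g = 0" for p
  proof (rule ccontr)
    assume "G b p \<noteq> 0"
    define n where "n = (cmod (G b p))\<^sup>2"
    have n: "n > 0" using \<open>G b p \<noteq> 0\<close> by (simp add: n_def)
    \<comment> \<open>Without the quadratic term the form is affine in \<open>s\<close>; this value
      makes it equal to -1.\<close>
    define s where "s = (Re (G p p) + 1) / (2 * n)"
    have Gn: "cnj (G b p) * G b p = of_real n"
      by (simp add: n_def complex_norm_square mult.commute flip: of_real_power)
    have "cnj (- of_real s * G b p) * G b p + G p b * (- of_real s * G b p) + G p p =
        - 2 * of_real s * (cnj (G b p) * G b p) + G p p"
      by (simp add: herm[OF p] algebra_simps)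
    also have "\<dots> = of_real (- 2 * s * n) + G p p"
      by (simp add: Gn)
    finally have "Re (of_real (- 2 * s * n) + G p p) \<ge> 0"
      using pair[OF p, of "- of_real s * G b p"] \<open>g = 0\<close>
      by (simp add: Gbb complex_nonneg_Reals_iff)
    moreover have "- 2 * s * n = - Re (G p p) - 1"
      using n by (simp add: s_def)
    ultimately show False by simp
  qed
  define G' where "G' = (\<lambda>p q. G p q - G p b * G b q / of_real g)"
  have "positive_semidefinite_on P G'"
    unfolding positive_semidefinite_on_def
  proof
    fix c
    define u where "u = (\<Sum>q\<in>P. G b q * c q)"
    define Q where "Q = (\<Sum>p\<in>P. \<Sum>q\<in>P. cnj (c p) * G p q * c q)"
    have cu: "(\<Sum>p\<in>P. cnj (c p) * G p b) = cnj u"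
      unfolding u_def cnj_sum by (intro sum.cong) (simp_all add: herm)
    have "(\<Sum>p\<in>P. \<Sum>q\<in>P. cnj (c p) * G' p q * c q) =
        Q - (\<Sum>p\<in>P. \<Sum>q\<in>P. (cnj (c p) * G p b) * (G b q * c q)) / of_real g"
      unfolding Q_def G'_def sum_divide_distrib sum_subtractf[symmetric]
      by (intro sum.cong) (simp_all add: algebra_simps)
    also have "\<dots> = Q - cnj u * u / of_real g"
      unfolding sum_product[symmetric] cu u_def[symmetric] ..
    \<comment> \<open>Completing the square: the Schur complement at \<open>c\<close> is the form of
      \<open>G\<close> at the minimizing \<open>t = - u / of_real g\<close>, which is
      \<open>t = 0\<close> if the pivot vanishes.\<close>
    also have "\<dots> = cnj (- u / of_real g) * G b b * (- u / of_real g) + cnj (- u / of_real g) * u +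
        cnj u * (- u / of_real g) + Q"
      by (cases "g = 0") (simp_all add: Gbb field_simps)
    also have "\<dots> \<in> \<real>\<^sub>\<ge>\<^sub>0"
      using ins[of "- u / of_real g" c] unfolding cu u_def[symmetric] Q_def[symmetric] .
    finally show "(\<Sum>p\<in>P. \<Sum>q\<in>P. cnj (c p) * G' p q * c q) \<in> \<real>\<^sub>\<ge>\<^sub>0" .
  qed
  then obtain r :: nat and R
    where R: "\<forall>p\<in>P. \<forall>q\<in>P. G' p q = (\<Sum>l<r. cnj (R l p) * R l q)"
    using insert.IH by blast
  define R' where "R' = (\<lambda>l p. if l = r then G b p / of_real (sqrt g) else if p = b then 0 else R l p)"
  have R'r: "(\<Sum>l<Suc r. cnj (R' l p) * R' l q) =
      (if p = b \<or> q = b then 0 else \<Sum>l<r. cnj (R l p) * R l q) + cnj (G b p) * G b q / of_real g" for p q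
  proof -
    have "complex_of_real (sqrt g) * of_real (sqrt g) = of_real g"
      using g by (simp flip: of_real_mult)
    then have "cnj (R' r p) * R' r q = cnj (G b p) * G b q / of_real g"
      by (simp add: R'_def)
    moreover have "(\<Sum>l<r. cnj (R' l p) * R' l q) = (if p = b \<or> q = b then 0 else \<Sum>l<r. cnj (R l p) * R l q)"
      by (auto simp: R'_def)
    ultimately show ?thesis by simp
  qed
  have "G p q = (\<Sum>l<Suc r. cnj (R' l p) * R' l q)" if pq: "p \<in> insert b P" "q \<in> insert b P" for p q
  proof (cases "p = b \<or> q = b")
    case True
    then consider "p = b" | "q = b" by blast
    then show ?thesis
    proof cases
      case 1
      then show ?thesis
        unfolding R'r using null[of q] pq by (cases "g = 0"; cases "q = b") (auto simp: Gbb)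
    next
      case 2
      then show ?thesis
        unfolding R'r using null[of p] herm[of p] pq by (cases "g = 0"; cases "p = b") (auto simp: Gbb)
    qed
  next
    case False
    then have "p \<in> P" "q \<in> P" using pq by auto
    then show ?thesis
      using False R herm[of p] unfolding R'r G'_def by (simp add: diff_eq_eq)
  qed
  then show ?case by blast
qed

section \<open>Finite-dimensional coordinate spaces\<close>

text \<open>The dimension depends on a rank found inside the proof, so it cannot be encoded in a
  type. It is the size of the allowed support \<open>J\<close> instead.\<close>

definition coord_space :: "'j set \<Rightarrow> ('j \<Rightarrow> complex) cinner_space" where
  "coord_space J = \<lparr>carrier = {x. \<forall>k. k \<notin> J \<longrightarrow> x k = 0}, mult = undefined, one = undefined,
     zero = (\<lambda>_. 0), add = (\<lambda>x y k. x k + y k), smult = (\<lambda>c x k. c * x k),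
     cinner = (\<lambda>x y. \<Sum>k\<in>J. cnj (x k) * y k)\<rparr>"

lemma coord_space_simps [simp]:
  "carrier (coord_space J) = {x. \<forall>k. k \<notin> J \<longrightarrow> x k = 0}"
  "\<zero>\<^bsub>coord_space J\<^esub> = (\<lambda>_. 0)"
  "x \<oplus>\<^bsub>coord_space J\<^esub> y = (\<lambda>k. x k + y k)"
  "c \<odot>\<^bsub>coord_space J\<^esub> x = (\<lambda>k. c * x k)"
  "\<llangle>x, y\<rrangle>\<^bsub>coord_space J\<^esub> = (\<Sum>k\<in>J. cnj (x k) * y k)"
  by (simp_all add: coord_space_def)

lemma Re_cnj_mult_self: "Re (cnj z * z) = (cmod z)\<^sup>2"
  by (simp add: cmod_power2 flip: power2_eq_square)

lemma cnorm_coord_space: "cnorm (coord_space J) x = sqrt (\<Sum>k\<in>J. (cmod (x k))\<^sup>2)"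
  unfolding cnorm_def coord_space_simps Re_sum Re_cnj_mult_self ..

lemma cmod_le_cnorm_coord_space:
  assumes "finite J" "k \<in> J"
  shows "cmod (x k) \<le> cnorm (coord_space J) x"
  unfolding cnorm_coord_space
  using assms by (intro real_le_rsqrt member_le_sum) auto

lemma inner_product_space_coord_space:
  assumes J: "finite J"
  shows "inner_product_space (coord_space J)"
proof -
  have "abelian_group (coord_space J)"
  proof (rule abelian_groupI)
    show "\<exists>y\<in>carrier (coord_space J). y \<oplus>\<^bsub>coord_space J\<^esub> x = \<zero>\<^bsub>coord_space J\<^esub>"
      if "x \<in> carrier (coord_space J)" for x
      using that by (intro bexI[of _ "\<lambda>k. - x k"]) auto
  qed (simp_all add: add_ac)
  then have "Module.module complex_ring (coord_space J)"
    by (intro module.intro module_axioms.intro cring_complex_ring) (simp_all add: algebra_simps)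
  then show ?thesis
  proof (intro inner_product_space.intro inner_product_space_axioms.intro)
    fix x assume x: "x \<in> carrier (coord_space J)" "x \<noteq> \<zero>\<^bsub>coord_space J\<^esub>"
    then obtain k where k: "k \<in> J" "x k \<noteq> 0" by fastforce
    have "0 < (\<Sum>k\<in>J. (cmod (x k))\<^sup>2)"
      using J k by (intro sum_pos2[of _ k]) auto
    then show "0 < Re \<llangle>x, x\<rrangle>\<^bsub>coord_space J\<^esub>"
      unfolding coord_space_simps Re_sum Re_cnj_mult_self .
  qed (simp_all add: algebra_simps sum.distrib sum_distrib_left)
qed

lemma coord_space_minus:
  assumes "finite J" "x \<in> carrier (coord_space J)" "y \<in> carrier (coord_space J)"
  shows "x \<ominus>\<^bsub>coord_space J\<^esub> y = (\<lambda>k. x k - y k)"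
proof -
  interpret inner_product_space "coord_space J"
    by (rule inner_product_space_coord_space[OF assms(1)])
  have "(x \<ominus>\<^bsub>coord_space J\<^esub> y) \<oplus>\<^bsub>coord_space J\<^esub> y = x"
    using assms(2,3) by (simp only: M.minus_eq M.a_assoc M.l_neg M.a_inv_closed M.r_zero)
  then have "(x \<ominus>\<^bsub>coord_space J\<^esub> y) k + y k = x k" for k
    unfolding coord_space_simps by (rule fun_cong)
  then show ?thesis
    by (simp add: fun_eq_iff eq_diff_eq)
qed

lemma hilbert_space_coord_space:
  assumes J: "finite J"
  shows "hilbert_space (coord_space J)"
proof (intro hilbert_space.intro hilbert_space_axioms.intro inner_product_space_coord_space[OF J])
  fix s :: "nat \<Rightarrow> 'a \<Rightarrow> complex"
  assume s: "\<And>i. s i \<in> carrier (coord_space J)"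
    and cauchy: "\<And>e. 0 < e \<Longrightarrow>
      \<exists>N. \<forall>i\<ge>N. \<forall>j\<ge>N. cnorm (coord_space J) (s i \<ominus>\<^bsub>coord_space J\<^esub> s j) < e"
  have cauchy': "\<exists>N. \<forall>i\<ge>N. \<forall>j\<ge>N. cnorm (coord_space J) (\<lambda>k. s i k - s j k) < e" if "0 < e" for e
    using cauchy[OF that] unfolding coord_space_minus[OF J s s] .
  have "\<exists>l. (\<lambda>i. s i k) \<longlonglongrightarrow> l" if k: "k \<in> J" for k
  proof -
    have "Cauchy (\<lambda>i. s i k)"
    proof (rule metric_CauchyI)
      fix e :: real assume "0 < e"
      then obtain N where "\<And>i j. i \<ge> N \<Longrightarrow> j \<ge> N \<Longrightarrow> cnorm (coord_space J) (\<lambda>k. s i k - s j k) < e"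
        using cauchy'[of e] by blast
      then have "dist (s i k) (s j k) < e" if "i \<ge> N" "j \<ge> N" for i j
        using cmod_le_cnorm_coord_space[OF J k, of "\<lambda>k. s i k - s j k"] that
        unfolding dist_norm by (meson le_less_trans)
      then show "\<exists>N. \<forall>i\<ge>N. \<forall>j\<ge>N. dist (s i k) (s j k) < e" by blast
    qed
    then show ?thesis
      using Cauchy_convergent convergent_def by blast
  qed
  then obtain l where l: "\<And>k. k \<in> J \<Longrightarrow> (\<lambda>i. s i k) \<longlonglongrightarrow> l k" by metis
  define x where "x = (\<lambda>k. if k \<in> J then l k else 0)"
  have x: "x \<in> carrier (coord_space J)" by (simp add: x_def)
  have "(\<lambda>i. sqrt (\<Sum>k\<in>J. (cmod (s i k - x k))\<^sup>2)) \<longlonglongrightarrow> sqrt (\<Sum>k\<in>J. (cmod (x k - x k))\<^sup>2)"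
    by (intro tendsto_intros) (simp add: x_def l)
  then have "(\<lambda>i. cnorm (coord_space J) (s i \<ominus>\<^bsub>coord_space J\<^esub> x)) \<longlonglongrightarrow> 0"
    unfolding coord_space_minus[OF J s x] cnorm_coord_space by simp
  then show "\<exists>x\<in>carrier (coord_space J). (\<lambda>i. cnorm (coord_space J) (s i \<ominus>\<^bsub>coord_space J\<^esub> x)) \<longlonglongrightarrow> 0"
    using x by blast
qed

lemma fin_dim_coord_space:
  assumes J: "finite J"
  shows "fin_dim (coord_space J)"
proof -
  interpret inner_product_space "coord_space J" by (rule inner_product_space_coord_space[OF J])
  define \<delta> :: "'a \<Rightarrow> 'a \<Rightarrow> complex" where "\<delta> = (\<lambda>k l. if l = k then 1 else 0)"
  have inj: "inj_on \<delta> J" by (rule inj_onI) (metis \<delta>_def zero_neq_one)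
  have \<delta>: "\<delta> ` J \<subseteq> carrier (coord_space J)" by (auto simp: \<delta>_def)
  have "\<exists>c. x = (\<Oplus>\<^bsub>coord_space J\<^esub>b\<in>\<delta> ` J. c b \<odot>\<^bsub>coord_space J\<^esub> b)"
    if x: "x \<in> carrier (coord_space J)" for x
  \<comment> \<open>Coefficients must be given as a function of the basis vector rather than of its
    index; the inner product is one.\<close>
  proof (intro exI[of _ "\<lambda>b. \<llangle>b, x\<rrangle>\<^bsub>coord_space J\<^esub>"] cinner_eqI[OF x])
    let ?y = "\<Oplus>\<^bsub>coord_space J\<^esub>b\<in>\<delta> ` J. \<llangle>b, x\<rrangle>\<^bsub>coord_space J\<^esub> \<odot>\<^bsub>coord_space J\<^esub> b"
    have f: "(\<lambda>b. \<llangle>b, x\<rrangle>\<^bsub>coord_space J\<^esub> \<odot>\<^bsub>coord_space J\<^esub> b) \<in> \<delta> ` J \<rightarrow> carrier (coord_space J)"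
      by (rule Pi_I, rule smult_in_carrier) (use \<delta> in blast)
    show "?y \<in> carrier (coord_space J)" using f by (rule M.finsum_closed)
    fix z assume z: "z \<in> carrier (coord_space J)"
    have "\<llangle>z, ?y\<rrangle>\<^bsub>coord_space J\<^esub> =
        (\<Sum>k\<in>J. \<llangle>z, \<llangle>\<delta> k, x\<rrangle>\<^bsub>coord_space J\<^esub> \<odot>\<^bsub>coord_space J\<^esub> \<delta> k\<rrangle>\<^bsub>coord_space J\<^esub>)"
      unfolding cinner_finsum_right[OF f z] by (rule sum.reindex_cong[OF inj refl refl])
    also have "\<dots> = (\<Sum>k\<in>J. cnj (z k) * x k)"
    proof (rule sum.cong[OF refl])
      fix k assume k: "k \<in> J"
      have 1: "(\<Sum>l\<in>J. cnj (\<delta> k l) * f l) = f k" "(\<Sum>l\<in>J. f l * (a * \<delta> k l)) = f k * a" for f a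
        using J k by (simp_all add: \<delta>_def if_distrib[where f = "\<lambda>x. _ * x"]
            if_distrib[where f = "\<lambda>x. x * _"] if_distrib[where f = cnj] cong: if_cong)
      show "\<llangle>z, \<llangle>\<delta> k, x\<rrangle>\<^bsub>coord_space J\<^esub> \<odot>\<^bsub>coord_space J\<^esub> \<delta> k\<rrangle>\<^bsub>coord_space J\<^esub> = cnj (z k) * x k"
        by (simp add: 1)
    qed
    finally show "\<llangle>z, x\<rrangle>\<^bsub>coord_space J\<^esub> = \<llangle>z, ?y\<rrangle>\<^bsub>coord_space J\<^esub>"
      by simp
  qed
  then show ?thesis
    unfolding fin_dim_def using \<delta> J by (intro exI[of _ "\<delta> ` J"]) blast
qed

section \<open>Existence of purifications\<close>

text \<open>Squared norms are inner products, for which estimates need no square roots.\<close>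

lemma bounded_opsI:
  assumes H: "inner_product_space H" and K: "inner_product_space K"
    and closed: "\<And>x. x \<in> carrier H \<Longrightarrow> T x \<in> carrier K"
    and add: "\<And>x y. x \<in> carrier H \<Longrightarrow> y \<in> carrier H \<Longrightarrow> T (x \<oplus>\<^bsub>H\<^esub> y) = T x \<oplus>\<^bsub>K\<^esub> T y"
    and smult: "\<And>c x. x \<in> carrier H \<Longrightarrow> T (c \<odot>\<^bsub>H\<^esub> x) = c \<odot>\<^bsub>K\<^esub> T x"
    and bound: "\<And>x. x \<in> carrier H \<Longrightarrow> (cnorm K (T x))\<^sup>2 \<le> M * (cnorm H x)\<^sup>2"
  shows "T \<in> bounded_ops H K"
proof -
  have "cnorm K (T x) \<le> sqrt M * cnorm H x" if x: "x \<in> carrier H" for x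
  proof -
    have nonneg: "0 \<le> cnorm H x"
      unfolding cnorm_def using inner_product_space.cinner_self_nonneg[OF H x] by simp
    have "cnorm K (T x) \<le> sqrt (M * (cnorm H x)\<^sup>2)"
      using bound[OF x] by (rule real_le_rsqrt)
    then show ?thesis
      using nonneg by (simp add: real_sqrt_mult)
  qed
  then show ?thesis
    unfolding bounded_ops_def using closed add smult by blast
qed

section \<open>The Choi matrix of a completely positive map\<close>

context inner_product_space
begin

lemma cinner_basis_left:
  assumes E: "orthonormal_basis E" and x: "x \<in> carrier H" and y: "y \<in> carrier H"
  shows "\<llangle>x, y\<rrangle> = (\<Sum>e\<in>E. cnj \<llangle>e, x\<rrangle> * \<llangle>e, y\<rrangle>)"
proof -
  have EH: "finite E" "E \<subseteq> carrier H" and ex: "x = (\<Oplus>e\<in>E. \<llangle>e, x\<rrangle> \<odot> e)"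
    using E x unfolding orthonormal_basis_def by blast+
  have f: "(\<lambda>e. \<llangle>e, x\<rrangle> \<odot> e) \<in> E \<rightarrow> carrier H" using EH by auto
  have "\<llangle>x, y\<rrangle> = \<llangle>(\<Oplus>e\<in>E. \<llangle>e, x\<rrangle> \<odot> e), y\<rrangle>"
    using ex by (rule arg_cong)
  also have "\<dots> = (\<Sum>e\<in>E. \<llangle>\<llangle>e, x\<rrangle> \<odot> e, y\<rrangle>)"
    by (rule cinner_finsum_left[OF f y])
  also have "\<dots> = (\<Sum>e\<in>E. cnj \<llangle>e, x\<rrangle> * \<llangle>e, y\<rrangle>)"
    by (rule sum.cong[OF refl], rule cinner_smult_left) (use EH y in auto)
  finally show ?thesis .
qed

text \<open>The block matrix of all matrix units is positive: it equals \<open>b\<close> adjoint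
  times \<open>b\<close> for a \<open>b\<close> with a single nonzero row. Complete positivity at
  size \<open>CARD('n)\<close> is applied to it, with \<open>h\<close> translating between natural
  numbers and matrix indices.\<close>

lemma completely_positive_choi:
  fixes \<phi> :: "complex^'n^'n \<Rightarrow> 'a \<Rightarrow> 'a"
  assumes cp: "completely_positive H \<phi>" and y: "\<And>i. y i \<in> carrier H"
  shows "(\<Sum>i\<in>UNIV. \<Sum>j\<in>UNIV. \<llangle>y i, \<phi> (matrix_unit i j) (y j)\<rrangle>) \<in> \<real>\<^sub>\<ge>\<^sub>0"
proof -
  let ?m = "CARD('n)"
  obtain h where h: "bij_betw h {..<?m} (UNIV :: 'n set)"
    using ex_bij_betw_nat_finite[of "UNIV :: 'n set"] by (auto simp: atLeast0LessThan)
  have "positive_matrix_over ?m (\<lambda>p q. matrix_unit (h p) (h q))"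
    unfolding positive_matrix_over_def
  proof (intro exI[of _ "\<lambda>k p. if k = 0 then matrix_unit (h 0) (h p) else 0"] allI impI)
    fix p q
    have "(\<Sum>k<?m. matrix_adj (if k = 0 then matrix_unit (h 0) (h p) else 0) **
          (if k = 0 then matrix_unit (h 0) (h q) else 0)) =
        (\<Sum>k<?m. if k = 0 then matrix_unit (h p) (h q) else 0)"
      by (intro sum.cong) (auto simp: matrix_unit_mult)
    then show "matrix_unit (h p) (h q) =
        (\<Sum>k<?m. matrix_adj (if k = 0 then matrix_unit (h 0) (h p) else 0) **
          (if k = 0 then matrix_unit (h 0) (h q) else 0))"
      by simp
  qed
  then have "positive_op_matrix H ?m (\<lambda>p q. \<phi> (matrix_unit (h p) (h q)))"
    using cp unfolding completely_positive_def by blast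
  then have "(\<Sum>p<?m. \<Sum>q<?m. \<llangle>y (h p), \<phi> (matrix_unit (h p) (h q)) (y (h q))\<rrangle>) \<in> \<real>\<^sub>\<ge>\<^sub>0"
    unfolding positive_op_matrix_def
    by (elim ballE[where x = "\<lambda>p. y (h p)"]) (use y in auto)
  also have "(\<Sum>p<?m. \<Sum>q<?m. \<llangle>y (h p), \<phi> (matrix_unit (h p) (h q)) (y (h q))\<rrangle>) =
      (\<Sum>p<?m. \<Sum>j\<in>UNIV. \<llangle>y (h p), \<phi> (matrix_unit (h p) j) (y j)\<rrangle>)"
    by (intro sum.cong refl sum.reindex_bij_betw[OF h])
  also have "\<dots> = (\<Sum>i\<in>UNIV. \<Sum>j\<in>UNIV. \<llangle>y i, \<phi> (matrix_unit i j) (y j)\<rrangle>)"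
    by (rule sum.reindex_bij_betw[OF h])
  finally show ?thesis .
qed

text \<open>
  The functionals \<open>\<lambda>x. g l i x\<close> are the components of the Kraus operators of \<open>\<phi>\<close>; they come from
  factorizing its Choi matrix.
\<close>

lemma ocp_map_factorization:
  fixes \<phi> :: "complex^'n^'n \<Rightarrow> 'a \<Rightarrow> 'a"
  assumes fin: "fin_dim H" and \<phi>: "ocp_map H \<phi>"
  obtains r :: nat and g :: "nat \<Rightarrow> 'n \<Rightarrow> 'a \<Rightarrow> complex"
  where "\<And>l i x y. x \<in> carrier H \<Longrightarrow> y \<in> carrier H \<Longrightarrow> g l i (x \<oplus> y) = g l i x + g l i y"
    and "\<And>l i c x. x \<in> carrier H \<Longrightarrow> g l i (c \<odot> x) = c * g l i x"
    and "\<And>i j x y. x \<in> carrier H \<Longrightarrow> y \<in> carrier H \<Longrightarrow>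
      \<llangle>x, \<phi> (matrix_unit i j) y\<rrangle> = (\<Sum>l<r. cnj (g l i x) * g l j y)"
proof -
  interpret inner_product_space_pair H H by unfold_locales
  have lin: "linear_into_ops H \<phi>" and cp: "completely_positive H \<phi>"
    using \<phi> unfolding ocp_map_def by blast+
  have B: "\<phi> a \<in> bounded_ops H H" for a
    using lin unfolding linear_into_ops_def by simp
  obtain E where E: "orthonormal_basis E"
    using fin_dim_orthonormal_basis[OF fin] .
  then have EH: "finite E" "E \<subseteq> carrier H"
    unfolding orthonormal_basis_def by blast+
  have EH': "e \<in> carrier H" if "e \<in> E" for e using EH that by blast
  define G where "G = (\<lambda>(i, e) (j, f). \<llangle>e, \<phi> (matrix_unit i j) f\<rrangle>)"
  have "positive_semidefinite_on (UNIV \<times> E) G"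
    unfolding positive_semidefinite_on_def
  proof
    fix c :: "'n \<times> 'a \<Rightarrow> complex"
    \<comment> \<open>Grouping the coefficients by matrix index turns the quadratic form of
      \<open>G\<close> into the sum that complete positivity controls.\<close>
    define y where "y = (\<lambda>i. \<Oplus>e\<in>E. c (i, e) \<odot> e)"
    have f: "(\<lambda>e. c (i, e) \<odot> e) \<in> E \<rightarrow> carrier H" for i
      using EH by auto
    have y: "y i \<in> carrier H" for i
      unfolding y_def using f by (rule M.finsum_closed)
    have left: "\<llangle>y i, z\<rrangle> = (\<Sum>e\<in>E. cnj (c (i, e)) * \<llangle>e, z\<rrangle>)" if z: "z \<in> carrier H" for i z
      unfolding y_def cinner_finsum_left[OF f z]
      by (rule sum.cong[OF refl], rule cinner_smult_left) (use EH z in auto)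
    have right: "\<llangle>z, \<phi> a (y j)\<rrangle> = (\<Sum>e\<in>E. c (j, e) * \<llangle>z, \<phi> a e\<rrangle>)" if z: "z \<in> carrier H" for j z a
      unfolding y_def cinner_op_finsum[OF B f EH(1) z]
      by (intro sum.cong refl)
        (simp add: bounded_opsD(3)[OF B] bounded_opsD(1)[OF B] EH' cinner_smult_right z)
    have "(\<Sum>p\<in>UNIV \<times> E. \<Sum>q\<in>UNIV \<times> E. cnj (c p) * G p q * c q) =
        (\<Sum>i\<in>UNIV. \<Sum>e\<in>E. \<Sum>j\<in>UNIV. \<Sum>f\<in>E. cnj (c (i, e)) * \<llangle>e, \<phi> (matrix_unit i j) f\<rrangle> * c (j, f))"
      by (simp add: G_def sum.cartesian_product')
    also have "\<dots> = (\<Sum>i\<in>UNIV. \<Sum>j\<in>UNIV. \<Sum>e\<in>E. \<Sum>f\<in>E. cnj (c (i, e)) * \<llangle>e, \<phi> (matrix_unit i j) f\<rrangle> * c (j, f))"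
      by (intro sum.cong refl sum.swap)
    also have "\<dots> = (\<Sum>i\<in>UNIV. \<Sum>j\<in>UNIV. \<llangle>y i, \<phi> (matrix_unit i j) (y j)\<rrangle>)"
    proof (intro sum.cong refl)
      fix i j :: 'n
      have "\<llangle>y i, \<phi> (matrix_unit i j) (y j)\<rrangle> = (\<Sum>e\<in>E. cnj (c (i, e)) * \<llangle>e, \<phi> (matrix_unit i j) (y j)\<rrangle>)"
        by (rule left[OF bounded_opsD(1)[OF B y]])
      also have "\<dots> = (\<Sum>e\<in>E. \<Sum>f\<in>E. cnj (c (i, e)) * \<llangle>e, \<phi> (matrix_unit i j) f\<rrangle> * c (j, f))"
        by (intro sum.cong refl) (simp add: right EH' sum_distrib_left mult_ac)
      finally show "(\<Sum>e\<in>E. \<Sum>f\<in>E. cnj (c (i, e)) * \<llangle>e, \<phi> (matrix_unit i j) f\<rrangle> * c (j, f)) =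
          \<llangle>y i, \<phi> (matrix_unit i j) (y j)\<rrangle>" ..
    qed
    also have "\<dots> \<in> \<real>\<^sub>\<ge>\<^sub>0"
      by (rule completely_positive_choi[OF cp y])
    finally show "(\<Sum>p\<in>UNIV \<times> E. \<Sum>q\<in>UNIV \<times> E. cnj (c p) * G p q * c q) \<in> \<real>\<^sub>\<ge>\<^sub>0" .
  qed
  then obtain r :: nat and R
    where R: "\<forall>p\<in>UNIV \<times> E. \<forall>q\<in>UNIV \<times> E. G p q = (\<Sum>l<r. cnj (R l p) * R l q)"
    using gram_factorization[of "UNIV \<times> E" G] EH(1) by auto
  \<comment> \<open>The linear extension of the Gram vectors from the basis to the whole
    space.\<close>
  define g where "g = (\<lambda>l i x. \<Sum>e\<in>E. \<llangle>e, x\<rrangle> * R l (i, e))"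
  show thesis
  proof (rule that[of g r])
    show "g l i (x \<oplus> y) = g l i x + g l i y" if "x \<in> carrier H" "y \<in> carrier H" for l i x y
      unfolding g_def sum.distrib[symmetric]
      by (intro sum.cong refl) (simp add: cinner_add_right EH' that distrib_right)
    show "g l i (c \<odot> x) = c * g l i x" if "x \<in> carrier H" for l i c x
      unfolding g_def sum_distrib_left
      by (intro sum.cong refl) (simp add: cinner_smult_right EH' that mult.assoc)
    fix i j x y assume x: "x \<in> carrier H" and y: "y \<in> carrier H"
    have Eij: "\<llangle>e, \<phi> (matrix_unit i j) f\<rrangle> = (\<Sum>l<r. cnj (R l (i, e)) * R l (j, f))"
      if "e \<in> E" "f \<in> E" for e f
      using R that unfolding G_def by auto
    have "\<llangle>x, \<phi> (matrix_unit i j) y\<rrangle> = (\<Sum>e\<in>E. cnj \<llangle>e, x\<rrangle> * \<llangle>e, \<phi> (matrix_unit i j) y\<rrangle>)"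
      by (rule cinner_basis_left[OF E x bounded_opsD(1)[OF B y]])
    also have "\<dots> = (\<Sum>e\<in>E. \<Sum>f\<in>E. \<Sum>l<r. (cnj \<llangle>e, x\<rrangle> * cnj (R l (i, e))) * (\<llangle>f, y\<rrangle> * R l (j, f)))"
    proof (rule sum.cong[OF refl])
      fix e assume e: "e \<in> E"
      have "cnj \<llangle>e, x\<rrangle> * \<llangle>e, \<phi> (matrix_unit i j) y\<rrangle> =
          (\<Sum>f\<in>E. cnj \<llangle>e, x\<rrangle> * (\<llangle>f, y\<rrangle> * \<llangle>e, \<phi> (matrix_unit i j) f\<rrangle>))"
        unfolding cinner_op_basis[OF B E y EH'[OF e]] by (rule sum_distrib_left)
      also have "\<dots> = (\<Sum>f\<in>E. \<Sum>l<r. (cnj \<llangle>e, x\<rrangle> * cnj (R l (i, e))) * (\<llangle>f, y\<rrangle> * R l (j, f)))"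
        by (intro sum.cong refl) (simp add: Eij e sum_distrib_left mult_ac)
      finally show "cnj \<llangle>e, x\<rrangle> * \<llangle>e, \<phi> (matrix_unit i j) y\<rrangle> =
          (\<Sum>f\<in>E. \<Sum>l<r. (cnj \<llangle>e, x\<rrangle> * cnj (R l (i, e))) * (\<llangle>f, y\<rrangle> * R l (j, f)))" .
    qed
    also have "\<dots> = (\<Sum>e\<in>E. \<Sum>l<r. \<Sum>f\<in>E. (cnj \<llangle>e, x\<rrangle> * cnj (R l (i, e))) * (\<llangle>f, y\<rrangle> * R l (j, f)))"
      by (intro sum.cong refl sum.swap)
    also have "\<dots> = (\<Sum>l<r. \<Sum>e\<in>E. \<Sum>f\<in>E. (cnj \<llangle>e, x\<rrangle> * cnj (R l (i, e))) * (\<llangle>f, y\<rrangle> * R l (j, f)))"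
      by (rule sum.swap)
    also have "\<dots> = (\<Sum>l<r. cnj (g l i x) * g l j y)"
      unfolding sum_product[symmetric] g_def cnj_sum complex_cnj_mult ..
    finally show "\<llangle>x, \<phi> (matrix_unit i j) y\<rrangle> = (\<Sum>l<r. cnj (g l i x) * g l j y)" .
  qed
qed

end

text \<open>
  The direct sum of \<open>r\<close> copies of the standard representation, on the space of coordinates
  \<open>idx (l, i)\<close> with \<open>l < r\<close>.
\<close>

locale amplification =
  fixes r :: nat and idx :: "nat \<times> 'n::finite \<Rightarrow> 'j"
  assumes inj_idx: "inj idx"
begin

text \<open>The injection \<open>idx\<close> places the pairs in a type chosen in advance; with
  values in \<open>nat\<close>, the type of the space depends neither on \<open>r\<close> nor on the
  matrix size.\<close>

definition index_set :: "'j set" where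
  "index_set = idx ` ({..<r} \<times> UNIV)"

abbreviation amp_space :: "('j \<Rightarrow> complex) cinner_space" where
  "amp_space \<equiv> coord_space index_set"

definition of_components :: "(nat \<Rightarrow> 'n \<Rightarrow> complex) \<Rightarrow> 'j \<Rightarrow> complex" where
  "of_components f = (\<lambda>k. if k \<in> index_set then case_prod f (inv_into UNIV idx k) else 0)"

definition amp :: "complex^'n^'n \<Rightarrow> ('j \<Rightarrow> complex) \<Rightarrow> 'j \<Rightarrow> complex" where
  "amp a x = of_components (\<lambda>l i. \<Sum>j\<in>UNIV. a $ i $ j * x (idx (l, j)))"

lemma finite_index_set: "finite index_set"
  by (simp add: index_set_def)

lemma of_components_idx [simp]: "l < r \<Longrightarrow> of_components f (idx (l, i)) = f l i"
  by (auto simp: of_components_def index_set_def inv_f_f[OF inj_idx])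

lemma of_components_in_carrier: "of_components f \<in> carrier amp_space"
  by (simp add: of_components_def)

lemma carrier_eqI:
  assumes "x \<in> carrier amp_space" "y \<in> carrier amp_space"
    and "\<And>l i. l < r \<Longrightarrow> x (idx (l, i)) = y (idx (l, i))"
  shows "x = y"
proof
  fix k
  show "x k = y k"
    using assms by (cases "k \<in> index_set") (auto simp: index_set_def)
qed

lemma cinner_components:
  "\<llangle>x, y\<rrangle>\<^bsub>amp_space\<^esub> = (\<Sum>l<r. \<Sum>i\<in>UNIV. cnj (x (idx (l, i))) * y (idx (l, i)))"
proof -
  have "inj_on idx ({..<r} \<times> UNIV)"
    using inj_idx by (rule inj_on_subset) simp
  then have "\<llangle>x, y\<rrangle>\<^bsub>amp_space\<^esub> = (\<Sum>p\<in>{..<r} \<times> UNIV. cnj (x (idx p)) * y (idx p))"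
    unfolding coord_space_simps index_set_def by (simp add: sum.reindex)
  then show ?thesis
    by (simp add: sum.cartesian_product')
qed

lemma amp_idx: "l < r \<Longrightarrow> amp a x (idx (l, i)) = (\<Sum>j\<in>UNIV. a $ i $ j * x (idx (l, j)))"
  by (simp add: amp_def)

lemma amp_in_carrier: "amp a x \<in> carrier amp_space"
  unfolding amp_def by (rule of_components_in_carrier)

sublocale inner_product_space amp_space
  by (rule inner_product_space_coord_space[OF finite_index_set])

lemma amp_bounded: "amp a \<in> bounded_ops amp_space amp_space"
proof (rule bounded_opsI)
  fix x y :: "'j \<Rightarrow> complex" and c :: complex
  show "amp a (x \<oplus>\<^bsub>amp_space\<^esub> y) = amp a x \<oplus>\<^bsub>amp_space\<^esub> amp a y"
    by (rule carrier_eqI)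
      (use amp_in_carrier in \<open>simp_all add: amp_idx distrib_left sum.distrib\<close>)
  show "amp a (c \<odot>\<^bsub>amp_space\<^esub> x) = c \<odot>\<^bsub>amp_space\<^esub> amp a x"
    by (rule carrier_eqI)
      (use amp_in_carrier in \<open>simp_all add: amp_idx sum_distrib_left mult_ac\<close>)
  \<comment> \<open>A crude bound: \<open>M\<close> times the norm of \<open>x\<close> dominates
    each coordinate, and summing the squares costs a factor \<open>card index_set\<close>.\<close>
  define M where "M = (\<Sum>i\<in>UNIV. \<Sum>j\<in>UNIV. cmod (a $ i $ j))"
  have le: "cmod (amp a x k) \<le> M * cnorm amp_space x" if "k \<in> index_set" for k
  proof -
    obtain l i where l: "l < r" and k: "k = idx (l, i)"
      using \<open>k \<in> index_set\<close> unfolding index_set_def by auto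
    have idx: "idx (l, j) \<in> index_set" for j
      using l by (simp add: index_set_def)
    have n: "0 \<le> cnorm amp_space x" unfolding cnorm_coord_space by (simp add: sum_nonneg)
    have "cmod (amp a x k) \<le> (\<Sum>j\<in>UNIV. cmod (a $ i $ j) * cmod (x (idx (l, j))))"
      unfolding k amp_idx[OF l] norm_mult[symmetric] by (rule norm_sum)
    also have "\<dots> \<le> (\<Sum>j\<in>UNIV. cmod (a $ i $ j) * cnorm amp_space x)"
      by (intro sum_mono mult_left_mono cmod_le_cnorm_coord_space[OF finite_index_set idx]) simp
    also have "\<dots> = (\<Sum>j\<in>UNIV. cmod (a $ i $ j)) * cnorm amp_space x"
      by (rule sum_distrib_right[symmetric])
    also have "\<dots> \<le> M * cnorm amp_space x"
      unfolding M_def by (intro mult_right_mono n member_le_sum) (simp_all add: sum_nonneg)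
    finally show ?thesis .
  qed
  have "(cnorm amp_space (amp a x))\<^sup>2 = (\<Sum>k\<in>index_set. (cmod (amp a x k))\<^sup>2)"
    unfolding cnorm_coord_space by (simp add: sum_nonneg)
  also have "\<dots> \<le> (\<Sum>k\<in>index_set. (M * cnorm amp_space x)\<^sup>2)"
    by (intro sum_mono power_mono le) simp_all
  also have "\<dots> = (real (card index_set) * M\<^sup>2) * (cnorm amp_space x)\<^sup>2"
    by (simp add: power_mult_distrib)
  finally show "(cnorm amp_space (amp a x))\<^sup>2 \<le> (real (card index_set) * M\<^sup>2) * (cnorm amp_space x)\<^sup>2" .
qed (use amp_in_carrier in \<open>simp_all add: inner_product_space_axioms\<close>)

lemma amp_unital_star_hom: "unital_star_hom amp_space amp"
  unfolding unital_star_hom_def linear_into_ops_def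
proof (intro conjI allI ballI)
  interpret inner_product_space_pair amp_space amp_space by unfold_locales
  show "amp a \<in> bounded_ops amp_space amp_space" for a by (rule amp_bounded)
  fix a b :: "complex^'n^'n" and c :: complex and x assume x: "x \<in> carrier amp_space"
  show "amp (a + b) x = amp a x \<oplus>\<^bsub>amp_space\<^esub> amp b x"
    by (rule carrier_eqI)
      (use amp_in_carrier in \<open>simp_all add: amp_idx distrib_right sum.distrib\<close>)
  show "amp (matrix_cscale c a) x = c \<odot>\<^bsub>amp_space\<^esub> amp a x"
    by (rule carrier_eqI)
      (use amp_in_carrier in \<open>simp_all add: amp_idx matrix_cscale_def map_matrix_def sum_distrib_left mult.assoc\<close>)
  show "amp (a ** b) x = amp a (amp b x)"
  proof (rule carrier_eqI[OF amp_in_carrier amp_in_carrier])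
    fix l i assume l: "l < r"
    have "amp (a ** b) x (idx (l, i)) = (\<Sum>k\<in>UNIV. \<Sum>j\<in>UNIV. a $ i $ j * (b $ j $ k * x (idx (l, k))))"
      using l by (simp add: amp_idx matrix_matrix_mult_def sum_distrib_right mult.assoc)
    also have "\<dots> = (\<Sum>j\<in>UNIV. \<Sum>k\<in>UNIV. a $ i $ j * (b $ j $ k * x (idx (l, k))))"
      by (rule sum.swap)
    also have "\<dots> = amp a (amp b x) (idx (l, i))"
      using l by (simp add: amp_idx sum_distrib_left)
    finally show "amp (a ** b) x (idx (l, i)) = amp a (amp b x) (idx (l, i))" .
  qed
  show "amp (mat 1) x = x"
  proof (rule carrier_eqI[OF amp_in_carrier x])
    fix l i assume "l < r"
    then show "amp (mat 1) x (idx (l, i)) = x (idx (l, i))"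
      by (simp add: amp_idx mat_def if_distrib[where f = "\<lambda>c. c * _"] cong: if_cong)
  qed
  show "amp (matrix_adj a) x = adj amp_space amp_space (amp a) x"
  proof (rule adj_eqI[symmetric, OF amp_in_carrier])
    fix z assume "z \<in> carrier amp_space"
    have "(\<Sum>i\<in>UNIV. cnj (amp (matrix_adj a) x (idx (l, i))) * z (idx (l, i))) =
        (\<Sum>j\<in>UNIV. cnj (x (idx (l, j))) * amp a z (idx (l, j)))" if l: "l < r" for l
    proof -
      have "(\<Sum>i\<in>UNIV. cnj (amp (matrix_adj a) x (idx (l, i))) * z (idx (l, i))) =
          (\<Sum>i\<in>UNIV. \<Sum>j\<in>UNIV. cnj (x (idx (l, j))) * (a $ j $ i * z (idx (l, i))))"
        unfolding amp_idx[OF l] cnj_sum sum_distrib_right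
        by (intro sum.cong refl) (simp add: matrix_adj_def map_matrix_def transpose_def mult_ac)
      also have "\<dots> = (\<Sum>j\<in>UNIV. \<Sum>i\<in>UNIV. cnj (x (idx (l, j))) * (a $ j $ i * z (idx (l, i))))"
        by (rule sum.swap)
      also have "\<dots> = (\<Sum>j\<in>UNIV. cnj (x (idx (l, j))) * amp a z (idx (l, j)))"
        using l by (simp add: amp_idx sum_distrib_left)
      finally show ?thesis .
    qed
    then show "\<llangle>amp (matrix_adj a) x, z\<rrangle>\<^bsub>amp_space\<^esub> = \<llangle>x, amp a z\<rrangle>\<^bsub>amp_space\<^esub>"
      unfolding cinner_components by (rule sum.cong[OF refl]) simp
  qed
qed

end

theorem purification_exists:
  fixes K :: "'k cinner_space" and \<phi> :: "complex^'n^'n \<Rightarrow> 'k \<Rightarrow> 'k"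
  assumes K: "inner_product_space K" and fin: "fin_dim K" and \<phi>: "ocp_map K \<phi>"
  shows "\<exists>(H :: (nat \<Rightarrow> complex) cinner_space) \<pi> V. purification \<phi> K H \<pi> V \<and> fin_dim H"
proof -
  interpret K: inner_product_space K by (rule K)
  have lin: "linear_into_ops K \<phi>"
    using \<phi> unfolding ocp_map_def by blast
  then have B: "\<phi> a \<in> bounded_ops K K" for a
    unfolding linear_into_ops_def by simp
  obtain r :: nat and g :: "nat \<Rightarrow> 'n \<Rightarrow> 'k \<Rightarrow> complex"
    where g_add: "\<And>l i x y. x \<in> carrier K \<Longrightarrow> y \<in> carrier K \<Longrightarrow> g l i (x \<oplus>\<^bsub>K\<^esub> y) = g l i x + g l i y"
    and g_smult: "\<And>l i c x. x \<in> carrier K \<Longrightarrow> g l i (c \<odot>\<^bsub>K\<^esub> x) = c * g l i x"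
    and g: "\<And>i j x y. x \<in> carrier K \<Longrightarrow> y \<in> carrier K \<Longrightarrow>
      \<llangle>x, \<phi> (matrix_unit i j) y\<rrangle>\<^bsub>K\<^esub> = (\<Sum>l<r. cnj (g l i x) * g l j y)"
    by (rule K.ocp_map_factorization[OF fin \<phi>]) (rule that)
  have "countable (UNIV :: (nat \<times> 'n) set)"
    by (simp flip: UNIV_Times_UNIV)
  then interpret amplification r "to_nat_on (UNIV :: (nat \<times> 'n) set)"
    by unfold_locales (rule inj_on_to_nat_on)
  interpret inner_product_space_pair K amp_space by unfold_locales
  define V where "V = (\<lambda>x. of_components (\<lambda>l i. g l i x))"
  have Vc: "V x \<in> carrier amp_space" for x
    unfolding V_def by (rule of_components_in_carrier)
  \<comment> \<open>For matrix units this is the factorization of the Choi matrix; the general case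
    follows by expanding \<open>a\<close>.\<close>
  have compress: "\<llangle>V x, amp a (V y)\<rrangle>\<^bsub>amp_space\<^esub> = \<llangle>x, \<phi> a y\<rrangle>\<^bsub>K\<^esub>"
    if x: "x \<in> carrier K" and y: "y \<in> carrier K" for x y a
  proof -
    have "\<llangle>x, \<phi> a y\<rrangle>\<^bsub>K\<^esub> = (\<Sum>i\<in>UNIV. \<Sum>j\<in>UNIV. \<Sum>l<r. cnj (g l i x) * (a $ i $ j * g l j y))"
      by (subst K.linear_into_ops_expand[OF lin y x]) (simp add: g x y sum_distrib_left mult_ac)
    also have "\<dots> = (\<Sum>i\<in>UNIV. \<Sum>l<r. \<Sum>j\<in>UNIV. cnj (g l i x) * (a $ i $ j * g l j y))"
      by (intro sum.cong refl sum.swap)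
    also have "\<dots> = (\<Sum>l<r. \<Sum>i\<in>UNIV. \<Sum>j\<in>UNIV. cnj (g l i x) * (a $ i $ j * g l j y))"
      by (rule sum.swap)
    also have "\<dots> = \<llangle>V x, amp a (V y)\<rrangle>\<^bsub>amp_space\<^esub>"
      unfolding cinner_components by (intro sum.cong refl) (simp add: V_def amp_idx sum_distrib_left)
    finally show ?thesis ..
  qed
  have amp_one: "amp (mat 1) x = x" if "x \<in> carrier amp_space" for x
    using amp_unital_star_hom that unfolding unital_star_hom_def by blast
  have "V \<in> bounded_ops K amp_space"
  proof -
    obtain C where C: "\<And>x. x \<in> carrier K \<Longrightarrow> cnorm K (\<phi> (mat 1) x) \<le> C * cnorm K x"
      using B[of "mat 1"] unfolding bounded_ops_def by blast
    show ?thesis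
    proof (rule bounded_opsI[OF K inner_product_space_axioms Vc])
      show "V (x \<oplus>\<^bsub>K\<^esub> y) = V x \<oplus>\<^bsub>amp_space\<^esub> V y" if "x \<in> carrier K" "y \<in> carrier K" for x y
        by (rule carrier_eqI[OF Vc M.a_closed[OF Vc Vc]]) (simp add: V_def g_add that)
      show "V (c \<odot>\<^bsub>K\<^esub> x) = c \<odot>\<^bsub>amp_space\<^esub> V x" if "x \<in> carrier K" for c x
        by (rule carrier_eqI[OF Vc smult_in_carrier[OF Vc]]) (simp add: V_def g_smult that)
      fix x assume x: "x \<in> carrier K"
      have \<phi>x: "\<phi> (mat 1) x \<in> carrier K" by (rule bounded_opsD(1)[OF B x])
      \<comment> \<open>The squared norm of \<open>V x\<close> is
        \<open>\<llangle>x, \<phi> (mat 1) x\<rrangle>\<close>. Twice this is at most the sum of the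
        squared norms of \<open>x\<close> and \<open>\<phi> (mat 1) x\<close>, hence the constant
        \<open>(1 + C\<^sup>2) / 2\<close>.\<close>
      have "(cnorm K (\<phi> (mat 1) x))\<^sup>2 \<le> (C * cnorm K x)\<^sup>2"
        by (rule power_mono[OF C[OF x]]) (simp add: cnorm_def K.cinner_self_nonneg[OF \<phi>x])
      moreover have "(cnorm amp_space (V x))\<^sup>2 = Re \<llangle>x, \<phi> (mat 1) x\<rrangle>\<^bsub>K\<^esub>"
        unfolding compress[OF x x, symmetric] amp_one[OF Vc] cnorm_def
        by (rule real_sqrt_pow2[OF cinner_self_nonneg[OF Vc]])
      ultimately show "(cnorm amp_space (V x))\<^sup>2 \<le> (1 + C\<^sup>2) / 2 * (cnorm K x)\<^sup>2"
        using K.Re_cinner_le[OF x \<phi>x] by (simp add: power_mult_distrib algebra_simps)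
    qed
  qed
  moreover have "adj K amp_space V (amp a (V x)) = \<phi> a x" if x: "x \<in> carrier K" for a x
  proof (rule adj_eqI)
    show \<phi>x: "\<phi> a x \<in> carrier K" by (rule bounded_opsD(1)[OF B x])
    fix z assume z: "z \<in> carrier K"
    have "\<llangle>\<phi> a x, z\<rrangle>\<^bsub>K\<^esub> = cnj \<llangle>z, \<phi> a x\<rrangle>\<^bsub>K\<^esub>"
      by (rule K.cinner_commute[OF z \<phi>x])
    also have "\<dots> = cnj \<llangle>V z, amp a (V x)\<rrangle>\<^bsub>amp_space\<^esub>"
      unfolding compress[OF z x] ..
    also have "\<dots> = \<llangle>amp a (V x), V z\<rrangle>\<^bsub>amp_space\<^esub>"
      by (rule cinner_commute[OF Vc amp_in_carrier, symmetric])
    finally show "\<llangle>\<phi> a x, z\<rrangle>\<^bsub>K\<^esub> = \<llangle>amp a (V x), V z\<rrangle>\<^bsub>amp_space\<^esub>" .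
  qed
  ultimately have "purification \<phi> K amp_space amp V"
    unfolding purification_def
    using hilbert_space_coord_space[OF finite_index_set] amp_unital_star_hom by blast
  then show ?thesis
    using fin_dim_coord_space[OF finite_index_set] by blast
qed

theorem theorem7p30:
  fixes K :: "'k cinner_space"
    and \<phi> :: "complex^'n^'n \<Rightarrow> 'k \<Rightarrow> 'k"
  assumes "hilbert_space K" and "fin_dim K" and "ocp_map K \<phi>"
  shows "(\<exists>(H :: (nat \<Rightarrow> complex) cinner_space) \<pi> V. purification \<phi> K H \<pi> V \<and> fin_dim H) \<and>
    (\<forall>(H :: 'h cinner_space) \<pi> V (I :: 'i cinner_space) \<rho> W.
       purification \<phi> K H \<pi> V \<and> fin_dim H \<and>
       purification \<phi> K I \<rho> W \<and> fin_dim I \<and>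
       unitarily_equivalent H \<pi> I \<rho> \<longrightarrow>
       (\<exists>U. unitary_intertwiner H \<pi> I \<rho> U \<and> (\<forall>x\<in>carrier K. U (V x) = W x)))"
proof -
  have K: "inner_product_space K"
    using assms(1) by (rule hilbert_space.axioms(1))
  show ?thesis
    using purification_exists[OF K assms(2,3)] purification_unique[OF K assms(2)] by blast
qed

end
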